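(* Let $M$ be a Kähler-Poisson manifold with Kähler-Poisson tensor $g^{\bar lk}$, let $\nabla^\bullet$ be its Kähler-Poisson contravariant connection, and let $P,Q$ be the tensors with $P^k_m=\delta^k_m$, $Q^{\bar l}_{\bar n}=\delta^{\bar l}_{\bar n}$ and all other components zero ($k,m$ holomorphic, $\bar l,\bar n$ antiholomorphic indices). Then Fedosov's formal symplectic groupoid on $(T^*M,Z)$ constructed from the data $(\nabla^\bullet,P,Q)$ is the formal symplectic groupoid with separation of variables; that is, its source map $S$ and target map $T$ satisfy $Sa=a$ and $Tb=b$ for every local holomorphic function $a$ and every local antiholomorphic function $b$ on $M$ (functions on $M$ being identified with their pullbacks to $(T^*M,Z)$).
   Context: Summation over repeated indices is understood. All functions, tensors and formal functions are complex-valued. **Kähler-Poisson manifolds.** A complex manifold $M$ is Kähler-Poisson if it carries a Poisson tensor of type $(1,1)$, given in local holomorphic coordinates $z^k$ by $g^{\bar lk}$, with $\pi^{\bar lk}=g^{\bar lk}$, $\pi^{k\bar l}=-g^{\bar lk}$, $\pi^{km}=\pi^{\bar l\bar n}=0$. Jacobi identity: $g^{\bar ts}\frac{\partial g^{\bar lk}}{\partial z^s}=g^{\bar ls}\frac{\partial g^{\bar tk}}{\partial z^s}$ and $g^{\bar ts}\frac{\partial g^{\bar lk}}{\partial\bar z^t}=g^{\bar tk}\frac{\partial g^{\bar ls}}{\partial\bar z^t}$. The Kähler-Poisson contravariant connection has Christoffel symbols $\Gamma^{\bar lk}_m=-\partial g^{\bar lk}/\partial z^m$, $\Gamma^{k\bar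 l}_{\bar n}=\partial g^{\bar lk}/\partial\bar z^n$, all others zero, with the convention $\nabla^{dx^i}dx^j=-\Gamma^{ij}_kdx^k$. It is torsion-free and respects the Poisson bivector field $\Pi$. **General notation.** $\pi^{ij}=\Pi(dx^i,dx^j)$; $\langle\beta,\#\alpha\rangle=\Pi(\alpha,\beta)$; $[\alpha,\beta]=\mathcal L_{\#\alpha}\beta-\mathcal L_{\#\beta}\alpha-d\,\Pi(\alpha,\beta)$ for 1-forms. $Z$ is the zero section of $p:T^*M\to M$; $C^\infty(T^*M,Z)=C^\infty(T^*M)/\bigcap_kI_Z^k$ ($I_Z$ the ideal of functions vanishing on $Z$), whose elements are locally formal power series in the fibre coordinates $\xi_i$ with coefficients smooth in $x$. $\bar\nabla^\alpha$ is $C^\infty(M)$-linear in $\alpha$ with $\bar\nabla^{dx^i}=\pi^{ij}\frac{\partial}{\partial x^j}+\Gamma^{ij}_k\xi_j\frac{\partial}{\partial\xi_k}$. For $\alpha=\alpha_idx^i$, $\hat\alpha=\alpha_i\partial/\partial\xi_i$. $\Omega=\frac12\pi^{ij}d\xi_i\wedge d\xi_j$. $\mathcal H_\Omega$ is the space of formal functions $F$ for which there is a vertical formal vector field $H_F=a_i\partial/\partial\xi_i$ with $\partial F/\partial\xi_i=\pi^{ij}a_j$; $\{F,G\}_\Omega=H_FG$ on $\mathcal H_\Omega$. $\mathcal E=\xi_k\partial/\partial\xi_k$. **The construction of $S$ and $T$.** A vertical 1-form $U$ on $(T^*M,Z)$ gives $U(\alpha)=\langle U,\hat\alpha\rangle$.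 Let $U$ be the unique global vertical 1-form such that $\langle U,\mathcal E\rangle=0$; locally there are formal functions $u_k,v^i_k$ with $\pi^{is}v^j_s=\pi^{js}\partial u_s/\partial\xi_i$, $U(dx^i)=\pi^{ik}u_k$, $u_k=-\xi_k\pmod{\xi^2}$, $v^i_k=\delta^i_k\pmod\xi$; and for all 1-forms $\alpha,\beta$ on $M$ $$\Pi(\alpha,\beta)=\bar Q(\alpha,\beta)-\bar\nabla^\alpha U(\beta)+\bar\nabla^\beta U(\alpha)+U([\alpha,\beta])+\{U(\alpha),U(\beta)\}_\Omega,$$ where $\bar Q(\alpha,\beta)=\frac12\Omega(\mathcal E,[\bar\nabla^\alpha,\bar\nabla^\beta]-\bar\nabla^{[\alpha,\beta]})$. For $f\in C^\infty(M)$ let $\theta(f)$ be the unique $F\in\mathcal H_\Omega$ with $\bar\nabla^\alpha F=\{U(\alpha),F\}_\Omega$ for all $\alpha$ and $F|_Z=p^*(f)|_Z$. Locally change variables $(x,\zeta)\mapsto(x,\xi)$ by $\xi_p=u_p(x,-\zeta_jP^j_{\,\cdot})-u_p(x,\zeta_jQ^j_{\,\cdot})$ (where $\zeta_jP^j_{\,\cdot}$ is the covector with components $\zeta_jP^j_k$), and set $(Sf)(x,\xi)=\theta(f)(x,-\zeta_jP^j_{\,\cdot})$, $(Tf)(x,\xi)=\theta(f)(x,\zeta_jQ^j_{\,\cdot})$. These are well defined globally (independent of the choice of $u_k$) and can be applied to local functions on $M$. Fedosov's formal symplectic groupoid constructed from $(\nabla^\bullet,P,Q)$ is the unique formal symplectic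 groupoid on $(T^*M,Z)$ with source map $S$ and target map $T$. A formal symplectic groupoid on $(T^*M,Z)$ with source $S$ and target $T$ is called a formal symplectic groupoid with separation of variables if $Sa=a$, $Tb=b$ for all local holomorphic $a$ and antiholomorphic $b$; it is known to be unique. *)

theory Defs
  imports "HOL-Analysis.Analysis" "HOL-Library.Multiset"
begin

section \<open>Formal power series in variables indexed by a type\<close>

text \<open>A series in the variables \<open>X i\<close> is the family of its coefficients; the multiset \<open>N\<close>
  stands for the monomial that is the product of the \<open>X i\<close> over \<open>i \<in># N\<close>.\<close>

typedef 'i mfps = "UNIV :: ('i multiset \<Rightarrow> complex) set"
  morphisms coeff Mfps by simp

lemma coeff_Mfps [simp]: "coeff (Mfps f) = f"
  by (simp add: Mfps_inverse)

lemma mfps_eqI: "(\<And>N. coeff s N = coeff t N) \<Longrightarrow> s = t"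
  by (metis coeff_inject ext)

definition splits :: "'i multiset \<Rightarrow> ('i multiset \<times> 'i multiset) set" where
  "splits N = {(K, L). K + L = N}"

lemma finite_splits [simp]: "finite (splits N)"
proof (rule finite_subset)
  have "finite {K. K \<subseteq># N}"
  proof (induction N)
    case empty
    then show ?case by simp
  next
    case (add x N)
    have "{K. K \<subseteq># add_mset x N} \<subseteq> {K. K \<subseteq># N} \<union> add_mset x ` {K. K \<subseteq># N}"
    proof
      fix K assume "K \<in> {K. K \<subseteq># add_mset x N}"
      then have K: "K \<subseteq># add_mset x N" by simp
      show "K \<in> {K. K \<subseteq># N} \<union> add_mset x ` {K. K \<subseteq># N}"
      proof (cases "x \<in># K")
        case True
        then obtain L where "K = add_mset x L" by (metis insert_DiffM)
        with K show ?thesis by simp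
      next
        case False
        with K have "K \<subseteq># N"
          by (metis Diff_eq_empty_iff_mset add_mset_remove_trivial diff_single_trivial
              minus_add_mset_if_not_in_lhs subset_eq_diff_conv union_mset_add_mset_right
              add.right_neutral)
        then show ?thesis by simp
      qed
    qed
    with add.IH show ?case by (meson finite_Un finite_imageI finite_subset)
  qed
  then show "finite ({K. K \<subseteq># N} \<times> {K. K \<subseteq># N})" by simp
qed (auto simp: splits_def)

instantiation mfps :: (type) comm_ring_1
begin

definition "0 = Mfps (\<lambda>_. 0)"
definition "1 = Mfps (\<lambda>N. if N = {#} then 1 else 0)"
definition "s + t = Mfps (\<lambda>N. coeff s N + coeff t N)"
definition "- s = Mfps (\<lambda>N. - coeff s N)"
definition "s - t = Mfps (\<lambda>N. coeff s N - coeff t N)"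
definition "s * t = Mfps (\<lambda>N. \<Sum>(K, L)\<in>splits N. coeff s K * coeff t L)"

instance
proof
  fix a b c :: "'a mfps"
  show "a + b + c = a + (b + c)" "a + b = b + a" "0 + a = a" "- a + a = 0" "a - b = a + - b"
    by (simp_all add: plus_mfps_def zero_mfps_def uminus_mfps_def minus_mfps_def add_ac
        coeff_inverse)
  show "(0::'a mfps) \<noteq> 1"
    by (auto simp: zero_mfps_def one_mfps_def Mfps_inject fun_eq_iff)
  show "(a + b) * c = a * c + b * c"
    by (simp add: times_mfps_def plus_mfps_def sum.distrib distrib_right case_prod_unfold)
  show "a * b = b * a"
  proof (rule mfps_eqI)
    fix N
    show "coeff (a * b) N = coeff (b * a) N"
      unfolding times_mfps_def coeff_Mfps
      by (rule sum.reindex_bij_witness[where i = prod.swap and j = prod.swap])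
         (auto simp: splits_def add.commute)
  qed
  show "1 * a = a"
  proof (rule mfps_eqI)
    fix N
    have "coeff (1 * a) N = (\<Sum>p\<in>splits N. if p = ({#}, N) then coeff a N else 0)"
      unfolding times_mfps_def one_mfps_def coeff_Mfps
      by (rule sum.cong) (auto simp: splits_def split: if_splits)
    also have "\<dots> = coeff a N"
      by (subst sum.delta[OF finite_splits]) (simp add: splits_def)
    finally show "coeff (1 * a) N = coeff a N" .
  qed
  show "a * b * c = a * (b * c)"
  proof (rule mfps_eqI)
    fix N
    have "coeff (a * b * c) N
        = (\<Sum>(p, q)\<in>(SIGMA p:splits N. splits (fst p)).
            coeff a (fst q) * coeff b (snd q) * coeff c (snd p))"
      by (simp add: times_mfps_def case_prod_unfold sum_distrib_right sum.Sigma)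
    also have "\<dots> = (\<Sum>(p, q)\<in>(SIGMA p:splits N. splits (snd p)).
            coeff a (fst p) * (coeff b (fst q) * coeff c (snd q)))"
      by (rule sum.reindex_bij_witness
          [where i = "\<lambda>((K, R), (L, J)). ((K + L, J), (K, L))"
             and j = "\<lambda>((R, J), (K, L)). ((K, L + J), (L, J))"])
         (auto simp: splits_def add.assoc mult.assoc)
    also have "\<dots> = coeff (a * (b * c)) N"
      by (simp add: times_mfps_def case_prod_unfold sum_distrib_left sum.Sigma)
    finally show "coeff (a * b * c) N = coeff (a * (b * c)) N" .
  qed
qed

end

definition const :: "complex \<Rightarrow> 'i mfps" where
  "const z = Mfps (\<lambda>N. if N = {#} then z else 0)"

definition X :: "'i \<Rightarrow> 'i mfps" where
  "X i = Mfps (\<lambda>N. if N = {#i#} then 1 else 0)"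

definition d_xi :: "'i \<Rightarrow> 'i mfps \<Rightarrow> 'i mfps" where
  "d_xi i s = Mfps (\<lambda>N. of_nat (Suc (count N i)) * coeff s (add_mset i N))"

text \<open>Substitution of \<open>w i\<close> for \<open>X i\<close>, used only for \<open>w\<close> without constant terms and for a finite
  index type; then a monomial of degree greater than \<open>size N\<close> does not contribute to the
  coefficient at \<open>N\<close>.\<close>

definition subst :: "'i mfps \<Rightarrow> ('i \<Rightarrow> 'i mfps) \<Rightarrow> 'i mfps" where
  "subst s w = Mfps (\<lambda>N. \<Sum>K | size K \<le> size N. coeff s K * coeff (\<Prod>i\<in>#K. w i) N)"


section \<open>Calculus on complex coordinate space\<close>

text \<open>\<open>Inl k\<close> is the holomorphic index \<open>k\<close> and \<open>Inr l\<close> the antiholomorphic index \<open>l\<close>, so that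
  \<open>x\<^sup>i\<close> is \<open>z\<^sup>k\<close> or the conjugate of \<open>z\<^sup>l\<close>.\<close>

type_synonym 'n idx = "'n + 'n"

definition coord :: "'n::finite idx \<Rightarrow> complex^'n \<Rightarrow> complex" where
  "coord i y = (case i of Inl k \<Rightarrow> y $ k | Inr l \<Rightarrow> cnj (y $ l))"

definition wirtinger :: "'n::finite idx \<Rightarrow> (complex^'n \<Rightarrow> complex) \<Rightarrow> complex^'n \<Rightarrow> complex" where
  "wirtinger i f y = (let D = frechet_derivative f (at y) in
     case i of Inl k \<Rightarrow> (D (axis k 1) - \<i> * D (axis k \<i>)) / 2
             | Inr l \<Rightarrow> (D (axis l 1) + \<i> * D (axis l \<i>)) / 2)"

definition smooth_on :: "(complex^'n) set \<Rightarrow> (complex^'n \<Rightarrow> complex) \<Rightarrow> bool" where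
  "smooth_on V f \<longleftrightarrow>
    (\<forall>vs. \<forall>y\<in>V. fold (\<lambda>v h y'. frechet_derivative h (at y') v) vs f differentiable (at y))"

definition holo_on :: "(complex^'n) set \<Rightarrow> (complex^'n \<Rightarrow> complex) \<Rightarrow> bool" where
  "holo_on V f \<longleftrightarrow> smooth_on V f \<and> (\<forall>y\<in>V. \<forall>l. wirtinger (Inr l) f y = 0)"


section \<open>Complex manifolds\<close>

text \<open>The manifold is the whole type \<open>'m\<close>, of complex dimension \<open>CARD('n)\<close>.\<close>

type_synonym ('m, 'n) chart = "'m set \<times> ('m \<Rightarrow> complex^'n)"

definition img :: "('m, 'n::finite) chart \<Rightarrow> 'm set \<Rightarrow> (complex^'n) set" where
  "img c W = snd c ` (fst c \<inter> W)"

definition pt :: "('m, 'n::finite) chart \<Rightarrow> complex^'n \<Rightarrow> 'm" where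
  "pt c = inv_into (fst c) (snd c)"

definition complex_atlas :: "('m::topological_space, 'n::finite) chart set \<Rightarrow> bool" where
  "complex_atlas A \<longleftrightarrow>
     (\<Union>c\<in>A. fst c) = UNIV \<and>
     (\<forall>c\<in>A. open (fst c) \<and> open (img c UNIV) \<and>
        homeomorphism (fst c) (img c UNIV) (snd c) (pt c)) \<and>
     (\<forall>c\<in>A. \<forall>c'\<in>A. \<forall>k. holo_on (img c' (fst c)) (\<lambda>y. snd c (pt c' y) $ k))"

definition smooth_fun :: "('m, 'n::finite) chart set \<Rightarrow> 'm set \<Rightarrow> ('m \<Rightarrow> complex) \<Rightarrow> bool" where
  "smooth_fun A W f \<longleftrightarrow> (\<forall>c\<in>A. smooth_on (img c W) (f \<circ> pt c))"

definition holo_fun :: "('m, 'n::finite) chart set \<Rightarrow> 'm set \<Rightarrow> ('m \<Rightarrow> complex) \<Rightarrow> bool" where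
  "holo_fun A W f \<longleftrightarrow> (\<forall>c\<in>A. holo_on (img c W) (f \<circ> pt c))"

definition antiholo_fun :: "('m, 'n::finite) chart set \<Rightarrow> 'm set \<Rightarrow> ('m \<Rightarrow> complex) \<Rightarrow> bool" where
  "antiholo_fun A W f \<longleftrightarrow> holo_fun A W (\<lambda>p. cnj (f p))"

text \<open>\<open>jac c c' i j p\<close> is the derivative of the \<open>i\<close>-th coordinate of \<open>c\<close> along the \<open>j\<close>-th
  coordinate of \<open>c'\<close> at the point \<open>p\<close> of both charts.\<close>

definition jac :: "('m, 'n::finite) chart \<Rightarrow> ('m, 'n) chart \<Rightarrow> 'n idx \<Rightarrow> 'n idx \<Rightarrow> 'm \<Rightarrow> complex" where
  "jac c c' i j p = wirtinger j (\<lambda>y. coord i (snd c (pt c' y))) (snd c' p)"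


section \<open>Formal functions on the formal neighbourhood of the zero section\<close>

text \<open>In a chart, a formal function is a series in the fibre coordinates \<open>X i\<close> (the \<open>\<xi>\<^sub>i\<close>) with
  coefficients depending on the base coordinates. Globally, it is a family of those, indexed
  by the charts and compatible on overlaps. The same holds for vertical vector fields and
  vertical 1-forms, which have an additional component index.\<close>

type_synonym 'n formal = "complex^'n \<Rightarrow> 'n idx mfps"

definition formal_on :: "(complex^'n) set \<Rightarrow> 'n formal \<Rightarrow> bool" where
  "formal_on V F \<longleftrightarrow> (\<forall>N. smooth_on V (\<lambda>y. coeff (F y) N))"

definition d_x :: "'n::finite idx \<Rightarrow> 'n formal \<Rightarrow> 'n formal" where
  "d_x i F y = Mfps (\<lambda>N. wirtinger i (\<lambda>y'. coeff (F y') N) y)"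

text \<open>Rewrites a series in the fibre coordinates of \<open>c'\<close> at \<open>p\<close> in those of \<open>c\<close>.\<close>

definition refibre ::
  "('m, 'n::finite) chart \<Rightarrow> ('m, 'n) chart \<Rightarrow> 'm \<Rightarrow> 'n idx mfps \<Rightarrow> 'n idx mfps" where
  "refibre c c' p s = subst s (\<lambda>i. \<Sum>j\<in>UNIV. const (jac c c' j i p) * X j)"

definition formal_function ::
  "('m, 'n::finite) chart set \<Rightarrow> 'm set \<Rightarrow> (('m, 'n) chart \<Rightarrow> 'n formal) \<Rightarrow> bool" where
  "formal_function A W F \<longleftrightarrow>
     (\<forall>c\<in>A. formal_on (img c W) (F c)) \<and>
     (\<forall>c\<in>A. \<forall>c'\<in>A. \<forall>p\<in>W \<inter> fst c \<inter> fst c'.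
        refibre c c' p (F c' (snd c' p)) = F c (snd c p))"

text \<open>The vector field with components \<open>a i\<close> along \<open>\<partial>/\<partial>\<xi>\<^sub>i\<close>.\<close>

definition vertical_vector_field ::
  "('m, 'n::finite) chart set \<Rightarrow> 'm set
    \<Rightarrow> (('m, 'n) chart \<Rightarrow> complex^'n \<Rightarrow> 'n idx \<Rightarrow> 'n idx mfps) \<Rightarrow> bool" where
  "vertical_vector_field A W a \<longleftrightarrow>
     (\<forall>c\<in>A. \<forall>i. formal_on (img c W) (\<lambda>y. a c y i)) \<and>
     (\<forall>c\<in>A. \<forall>c'\<in>A. \<forall>p\<in>W \<inter> fst c \<inter> fst c'. \<forall>i.
        refibre c c' p (a c' (snd c' p) i)
          = (\<Sum>j\<in>UNIV. const (jac c c' j i p) * a c (snd c p) j))"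

text \<open>The 1-form with components \<open>U i\<close> along \<open>d\<xi>\<^sub>i\<close>; thus \<open>U i\<close> is also the value of the form
  on \<open>dx\<^sup>i\<close>.\<close>

definition vertical_form ::
  "('m, 'n::finite) chart set \<Rightarrow> 'm set
    \<Rightarrow> (('m, 'n) chart \<Rightarrow> complex^'n \<Rightarrow> 'n idx \<Rightarrow> 'n idx mfps) \<Rightarrow> bool" where
  "vertical_form A W U \<longleftrightarrow>
     (\<forall>c\<in>A. \<forall>i. formal_on (img c W) (\<lambda>y. U c y i)) \<and>
     (\<forall>c\<in>A. \<forall>c'\<in>A. \<forall>p\<in>W \<inter> fst c \<inter> fst c'. \<forall>i.
        refibre c c' p (U c' (snd c' p) i)
          = (\<Sum>j\<in>UNIV. const (jac c' c i j p) * U c (snd c p) j))"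

definition pullback :: "('m \<Rightarrow> complex) \<Rightarrow> ('m, 'n::finite) chart \<Rightarrow> 'n formal" where
  "pullback f c y = const (f (pt c y))"


section \<open>Poisson tensors and contravariant connections in a chart\<close>

type_synonym 'n tensor2 = "complex^'n \<Rightarrow> 'n idx \<Rightarrow> 'n idx \<Rightarrow> complex"
type_synonym 'n tensor3 = "complex^'n \<Rightarrow> 'n idx \<Rightarrow> 'n idx \<Rightarrow> 'n idx \<Rightarrow> complex"
type_synonym 'n covector = "complex^'n \<Rightarrow> 'n idx \<Rightarrow> complex"

definition one_form_on :: "(complex^'n) set \<Rightarrow> 'n covector \<Rightarrow> bool" where
  "one_form_on V \<alpha> \<longleftrightarrow> (\<forall>i. smooth_on V (\<lambda>y. \<alpha> y i))"

definition biv :: "'n::finite tensor2 \<Rightarrow> 'n covector \<Rightarrow> 'n covector \<Rightarrow> complex^'n \<Rightarrow> complex" where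
  "biv \<pi> \<alpha> \<beta> y = (\<Sum>i\<in>UNIV. \<Sum>j\<in>UNIV. \<pi> y i j * \<alpha> y i * \<beta> y j)"

definition sharp :: "'n::finite tensor2 \<Rightarrow> 'n covector \<Rightarrow> complex^'n \<Rightarrow> 'n idx \<Rightarrow> complex" where
  "sharp \<pi> \<alpha> y j = (\<Sum>i\<in>UNIV. \<alpha> y i * \<pi> y i j)"

definition lie_form ::
  "(complex^'n \<Rightarrow> 'n idx \<Rightarrow> complex) \<Rightarrow> 'n covector \<Rightarrow> 'n covector" where
  "lie_form Y \<beta> y k =
     (\<Sum>j\<in>UNIV. Y y j * wirtinger j (\<lambda>y'. \<beta> y' k) y + \<beta> y j * wirtinger k (\<lambda>y'. Y y' j) y)"

definition form_bracket ::
  "'n::finite tensor2 \<Rightarrow> 'n covector \<Rightarrow> 'n covector \<Rightarrow> 'n covector" where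
  "form_bracket \<pi> \<alpha> \<beta> y k =
     lie_form (sharp \<pi> \<alpha>) \<beta> y k - lie_form (sharp \<pi> \<beta>) \<alpha> y k - wirtinger k (biv \<pi> \<alpha> \<beta>) y"

text \<open>The lifted connection on formal functions; \<open>\<Gamma> y i j k\<close> is the Christoffel symbol with upper
  indices \<open>i\<close>, \<open>j\<close> and lower index \<open>k\<close>.\<close>

definition nabla ::
  "'n::finite tensor2 \<Rightarrow> 'n tensor3 \<Rightarrow> 'n covector \<Rightarrow> 'n formal \<Rightarrow> 'n formal" where
  "nabla \<pi> \<Gamma> \<alpha> F y =
     (\<Sum>i\<in>UNIV. const (\<alpha> y i) *
        ((\<Sum>j\<in>UNIV. const (\<pi> y i j) * d_x j F y) +
         (\<Sum>j\<in>UNIV. \<Sum>k\<in>UNIV. const (\<Gamma> y i j k) * X j * d_xi k (F y))))"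

definition euler :: "'n::finite formal \<Rightarrow> 'n formal" where
  "euler F y = (\<Sum>k\<in>UNIV. X k * d_xi k (F y))"

text \<open>The 2-form \<open>\<Omega>\<close> on two vertical vector fields given as derivations.\<close>

definition Omega ::
  "'n::finite tensor2 \<Rightarrow> ('n formal \<Rightarrow> 'n formal) \<Rightarrow> ('n formal \<Rightarrow> 'n formal) \<Rightarrow> 'n formal" where
  "Omega \<pi> Y Z y = const (1/2) * (\<Sum>i\<in>UNIV. \<Sum>j\<in>UNIV. const (\<pi> y i j) *
     (Y (\<lambda>_. X i) y * Z (\<lambda>_. X j) y - Y (\<lambda>_. X j) y * Z (\<lambda>_. X i) y))"

definition Qbar ::
  "'n::finite tensor2 \<Rightarrow> 'n tensor3 \<Rightarrow> 'n covector \<Rightarrow> 'n covector \<Rightarrow> 'n formal" where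
  "Qbar \<pi> \<Gamma> \<alpha> \<beta> y = const (1/2) * Omega \<pi> euler
     (\<lambda>F y'. nabla \<pi> \<Gamma> \<alpha> (nabla \<pi> \<Gamma> \<beta> F) y' - nabla \<pi> \<Gamma> \<beta> (nabla \<pi> \<Gamma> \<alpha> F) y'
             - nabla \<pi> \<Gamma> (form_bracket \<pi> \<alpha> \<beta>) F y') y"

definition eval_form ::
  "(complex^'n \<Rightarrow> 'n::finite idx \<Rightarrow> 'n idx mfps) \<Rightarrow> 'n covector \<Rightarrow> 'n formal" where
  "eval_form U \<alpha> y = (\<Sum>i\<in>UNIV. const (\<alpha> y i) * U y i)"

text \<open>The bracket is computed in one fibre, with the matrix \<open>p\<close> of the Poisson tensor at the base
  point. Two choices of \<open>a\<close> differ by some \<open>b\<close> with \<open>(\<Sum>j. p i j * b j) = 0\<close>, which does not change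
  the bracket if \<open>G\<close> is also of the form required of \<open>F\<close>, because \<open>p\<close> is antisymmetric. So the
  choice need not be made smoothly in the base point.\<close>

definition Omega_bracket ::
  "('i::finite \<Rightarrow> 'i \<Rightarrow> complex) \<Rightarrow> 'i mfps \<Rightarrow> 'i mfps \<Rightarrow> 'i mfps" where
  "Omega_bracket p F G =
     (let a = (SOME a. \<forall>i. d_xi i F = (\<Sum>j\<in>UNIV. const (p i j) * a j))
      in \<Sum>i\<in>UNIV. a i * d_xi i G)"

definition H_Omega ::
  "('m, 'n::finite) chart set \<Rightarrow> (('m, 'n) chart \<Rightarrow> 'n tensor2) \<Rightarrow> 'm set
    \<Rightarrow> (('m, 'n) chart \<Rightarrow> 'n formal) \<Rightarrow> bool" where
  "H_Omega A \<pi> W F \<longleftrightarrow> formal_function A W F \<and>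
     (\<exists>a. vertical_vector_field A W a \<and>
        (\<forall>c\<in>A. \<forall>y\<in>img c W. \<forall>i.
           d_xi i (F c y) = (\<Sum>j\<in>UNIV. const (\<pi> c y i j) * a c y j)))"


section \<open>Fedosov's construction of the source and target maps\<close>

text \<open>The functions \<open>u k\<close> and \<open>v i k\<close> (upper index \<open>i\<close>, lower index \<open>k\<close>) on an open subset \<open>V\<close> of
  the coordinate domain.\<close>

definition local_data ::
  "'n::finite tensor2 \<Rightarrow> (complex^'n \<Rightarrow> 'n idx \<Rightarrow> 'n idx mfps) \<Rightarrow> (complex^'n) set
    \<Rightarrow> (complex^'n \<Rightarrow> 'n idx \<Rightarrow> 'n idx mfps)
    \<Rightarrow> (complex^'n \<Rightarrow> 'n idx \<Rightarrow> 'n idx \<Rightarrow> 'n idx mfps) \<Rightarrow> bool" where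
  "local_data \<pi> U V u v \<longleftrightarrow>
     (\<forall>k. formal_on V (\<lambda>y. u y k)) \<and> (\<forall>i k. formal_on V (\<lambda>y. v y i k)) \<and>
     (\<forall>y\<in>V.
       (\<forall>i j. (\<Sum>s\<in>UNIV. const (\<pi> y i s) * v y j s)
            = (\<Sum>s\<in>UNIV. const (\<pi> y j s) * d_xi i (u y s))) \<and>
       (\<forall>i. U y i = (\<Sum>k\<in>UNIV. const (\<pi> y i k) * u y k)) \<and>
       (\<forall>k. \<forall>N. size N < 2 \<longrightarrow> coeff (u y k) N = coeff (- X k) N) \<and>
       (\<forall>i k. coeff (v y i k) {#} = (if i = k then 1 else 0)))"

definition fedosov_form ::
  "('m, 'n::finite) chart set \<Rightarrow> (('m, 'n) chart \<Rightarrow> 'n tensor2) \<Rightarrow> (('m, 'n) chart \<Rightarrow> 'n tensor3)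
    \<Rightarrow> (('m, 'n) chart \<Rightarrow> complex^'n \<Rightarrow> 'n idx \<Rightarrow> 'n idx mfps) \<Rightarrow> bool" where
  "fedosov_form A \<pi> \<Gamma> U \<longleftrightarrow>
     vertical_form A UNIV U \<and>
     (\<forall>c\<in>A. \<forall>y\<in>img c UNIV. (\<Sum>i\<in>UNIV. X i * U c y i) = 0) \<and>
     (\<forall>c\<in>A. \<forall>y\<in>img c UNIV. \<exists>V. open V \<and> y \<in> V \<and> V \<subseteq> img c UNIV \<and>
        (\<exists>u v. local_data (\<pi> c) (U c) V u v)) \<and>
     (\<forall>c\<in>A. \<forall>V \<alpha> \<beta>. open V \<and> V \<subseteq> img c UNIV \<and> one_form_on V \<alpha> \<and> one_form_on V \<beta> \<longrightarrow>
        (\<forall>y\<in>V. const (biv (\<pi> c) \<alpha> \<beta> y) =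
           Qbar (\<pi> c) (\<Gamma> c) \<alpha> \<beta> y
           - nabla (\<pi> c) (\<Gamma> c) \<alpha> (eval_form (U c) \<beta>) y
           + nabla (\<pi> c) (\<Gamma> c) \<beta> (eval_form (U c) \<alpha>) y
           + eval_form (U c) (form_bracket (\<pi> c) \<alpha> \<beta>) y
           + Omega_bracket (\<pi> c y) (eval_form (U c) \<alpha> y) (eval_form (U c) \<beta> y)))"

definition is_theta ::
  "('m, 'n::finite) chart set \<Rightarrow> (('m, 'n) chart \<Rightarrow> 'n tensor2) \<Rightarrow> (('m, 'n) chart \<Rightarrow> 'n tensor3)
    \<Rightarrow> (('m, 'n) chart \<Rightarrow> complex^'n \<Rightarrow> 'n idx \<Rightarrow> 'n idx mfps) \<Rightarrow> 'm set
    \<Rightarrow> ('m \<Rightarrow> complex) \<Rightarrow> (('m, 'n) chart \<Rightarrow> 'n formal) \<Rightarrow> bool" where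
  "is_theta A \<pi> \<Gamma> U W f F \<longleftrightarrow>
     H_Omega A \<pi> W F \<and>
     (\<forall>c\<in>A. \<forall>V \<alpha>. open V \<and> V \<subseteq> img c W \<and> one_form_on V \<alpha> \<longrightarrow>
        (\<forall>y\<in>V. nabla (\<pi> c) (\<Gamma> c) \<alpha> (F c) y
                 = Omega_bracket (\<pi> c y) (eval_form (U c) \<alpha> y) (F c y))) \<and>
     (\<forall>c\<in>A. \<forall>y\<in>img c W. coeff (F c y) {#} = f (pt c y))"

text \<open>The components of \<open>\<zeta>\<^sub>j B\<^sup>j\<^sub>k\<close>, as linear forms in the variables \<open>\<zeta>\<^sub>j\<close>; here \<open>X j\<close> stands for
  \<open>\<zeta>\<^sub>j\<close>.\<close>

definition zeta_apply :: "('i::finite \<Rightarrow> 'i \<Rightarrow> complex) \<Rightarrow> 'i \<Rightarrow> 'i mfps" where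
  "zeta_apply B k = (\<Sum>j\<in>UNIV. X j * const (B j k))"

text \<open>\<open>\<xi>\<^sub>p\<close> as a formal function of \<open>(x, \<zeta>)\<close>, at a base point where the value of \<open>u\<close> is \<open>u\<close>.\<close>

definition xi_of_zeta ::
  "('i::finite \<Rightarrow> 'i \<Rightarrow> complex) \<Rightarrow> ('i \<Rightarrow> 'i \<Rightarrow> complex) \<Rightarrow> ('i \<Rightarrow> 'i mfps) \<Rightarrow> 'i \<Rightarrow> 'i mfps" where
  "xi_of_zeta P Q u p = subst (u p) (\<lambda>k. - zeta_apply P k) - subst (u p) (zeta_apply Q)"

text \<open>\<open>S\<close> and \<open>T\<close> are the source and target maps constructed from the connection and the tensors
  \<open>P\<close> and \<open>Q\<close>. They send a smooth function \<open>f\<close> on an open set \<open>W\<close> to a formal function over \<open>W\<close>,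
  which is determined by its expression in the variables \<open>(x, \<zeta>)\<close>.\<close>

definition fedosov_groupoid_maps ::
  "('m::topological_space, 'n::finite) chart set
    \<Rightarrow> (('m, 'n) chart \<Rightarrow> 'n tensor2) \<Rightarrow> (('m, 'n) chart \<Rightarrow> 'n tensor3)
    \<Rightarrow> (('m, 'n) chart \<Rightarrow> 'n tensor2) \<Rightarrow> (('m, 'n) chart \<Rightarrow> 'n tensor2)
    \<Rightarrow> ('m set \<Rightarrow> ('m \<Rightarrow> complex) \<Rightarrow> ('m, 'n) chart \<Rightarrow> 'n formal)
    \<Rightarrow> ('m set \<Rightarrow> ('m \<Rightarrow> complex) \<Rightarrow> ('m, 'n) chart \<Rightarrow> 'n formal) \<Rightarrow> bool" where
  "fedosov_groupoid_maps A \<pi> \<Gamma> P Q S T \<longleftrightarrow>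
     (\<exists>U. fedosov_form A \<pi> \<Gamma> U \<and>
       (\<forall>W f. open W \<and> smooth_fun A W f \<longrightarrow>
          formal_function A W (S W f) \<and> formal_function A W (T W f) \<and>
          (\<exists>F. is_theta A \<pi> \<Gamma> U W f F \<and>
            (\<forall>c\<in>A. \<forall>y0\<in>img c W. \<exists>V u v.
               open V \<and> y0 \<in> V \<and> V \<subseteq> img c W \<and> local_data (\<pi> c) (U c) V u v \<and>
               (\<forall>y\<in>V.
                  subst (S W f c y) (xi_of_zeta (P c y) (Q c y) (u y))
                    = subst (F c y) (\<lambda>k. - zeta_apply (P c y) k) \<and>
                  subst (T W f c y) (xi_of_zeta (P c y) (Q c y) (u y))
                    = subst (F c y) (zeta_apply (Q c y)))))))"

definition separation_of_variables ::
  "('m::topological_space, 'n::finite) chart set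
    \<Rightarrow> ('m set \<Rightarrow> ('m \<Rightarrow> complex) \<Rightarrow> ('m, 'n) chart \<Rightarrow> 'n formal)
    \<Rightarrow> ('m set \<Rightarrow> ('m \<Rightarrow> complex) \<Rightarrow> ('m, 'n) chart \<Rightarrow> 'n formal) \<Rightarrow> bool" where
  "separation_of_variables A S T \<longleftrightarrow>
     (\<forall>W a. open W \<and> holo_fun A W a \<longrightarrow>
        (\<forall>c\<in>A. \<forall>y\<in>img c W. S W a c y = pullback a c y)) \<and>
     (\<forall>W b. open W \<and> antiholo_fun A W b \<longrightarrow>
        (\<forall>c\<in>A. \<forall>y\<in>img c W. T W b c y = pullback b c y))"


section \<open>Kaehler-Poisson manifolds\<close>

text \<open>\<open>g y l k\<close> has the antiholomorphic index \<open>l\<close> first and the holomorphic index \<open>k\<close> second.\<close>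

definition kp_tensor :: "(complex^'n \<Rightarrow> 'n \<Rightarrow> 'n \<Rightarrow> complex) \<Rightarrow> 'n tensor2" where
  "kp_tensor g y i j =
     (case (i, j) of (Inr l, Inl k) \<Rightarrow> g y l k | (Inl k, Inr l) \<Rightarrow> - g y l k | _ \<Rightarrow> 0)"

definition kp_connection :: "(complex^'n \<Rightarrow> 'n \<Rightarrow> 'n \<Rightarrow> complex) \<Rightarrow> 'n tensor3" where
  "kp_connection g y i j s =
     (case (i, j, s) of
        (Inr l, Inl k, Inl m) \<Rightarrow> - wirtinger (Inl m) (\<lambda>y'. g y' l k) y
      | (Inl k, Inr l, Inr n) \<Rightarrow> wirtinger (Inr n) (\<lambda>y'. g y' l k) y
      | _ \<Rightarrow> 0)"

definition kaehler_poisson ::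
  "('m::topological_space, 'n::finite) chart set
    \<Rightarrow> (('m, 'n) chart \<Rightarrow> complex^'n \<Rightarrow> 'n \<Rightarrow> 'n \<Rightarrow> complex) \<Rightarrow> bool" where
  "kaehler_poisson A g \<longleftrightarrow>
     (\<forall>c\<in>A. \<forall>l k. smooth_on (img c UNIV) (\<lambda>y. g c y l k)) \<and>
     (\<forall>c\<in>A. \<forall>c'\<in>A. \<forall>p\<in>fst c \<inter> fst c'. \<forall>i j.
        kp_tensor (g c') (snd c' p) i j =
          (\<Sum>s\<in>UNIV. \<Sum>t\<in>UNIV.
             jac c' c i s p * jac c' c j t p * kp_tensor (g c) (snd c p) s t)) \<and>
     (\<forall>c\<in>A. \<forall>y\<in>img c UNIV. \<forall>t l k.
        (\<Sum>s\<in>UNIV. g c y t s * wirtinger (Inl s) (\<lambda>y'. g c y' l k) y) =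
        (\<Sum>s\<in>UNIV. g c y l s * wirtinger (Inl s) (\<lambda>y'. g c y' t k) y)) \<and>
     (\<forall>c\<in>A. \<forall>y\<in>img c UNIV. \<forall>s l k.
        (\<Sum>t\<in>UNIV. g c y t s * wirtinger (Inr t) (\<lambda>y'. g c y' l k) y) =
        (\<Sum>t\<in>UNIV. g c y t k * wirtinger (Inr t) (\<lambda>y'. g c y' l s) y))"

definition holo_proj :: "'n::finite tensor2" where
  "holo_proj y i j = (if i = j \<and> isl i then 1 else 0)"

definition antiholo_proj :: "'n::finite tensor2" where
  "antiholo_proj y i j = (if i = j \<and> \<not> isl i then 1 else 0)"

end

theory Submission
  imports Defs
begin

text \<open>Let \<open>D\<close> be the set of holomorphic indices, and restrict formal functions to the subspace
  where \<open>\<xi>\<^sub>i = 0\<close> for \<open>i \<notin> D\<close>. Since \<open>\<pi>\<close> vanishes on pairs of holomorphic indices and \<open>\<Gamma>\<close> only couples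
  antiholomorphic fibre coordinates along \<open>dz\<^sup>k\<close>, the term \<open>Q(dz\<^sup>k, dz\<^sup>m)\<close> restricts to \<open>0\<close>; the
  structure equation and \<open>\<langle>U, \<E>\<rangle> = 0\<close> then give, by induction on the degree, that \<open>U(dz\<^sup>k)\<close>
  restricts to \<open>0\<close>. With this, the equation \<open>\<nabla>F = {U, F}\<close> along \<open>dz\<^sup>k\<close> expresses the derivatives
  of the restriction of \<open>F = \<theta>(a)\<close> in terms of its antiholomorphic base derivatives, so that \<open>F\<close>
  restricts to \<open>a\<close> if \<open>a\<close> is holomorphic. As \<open>\<zeta>P\<close> lies in the subspace, \<open>Sa = a\<close>. The case
  of \<open>T\<close> is the same with the two kinds of indices exchanged.\<close>

section \<open>Coefficients\<close>

lemma coeff_0 [simp]: "coeff 0 N = 0"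
  by (simp add: zero_mfps_def)

lemma coeff_1: "coeff 1 N = (if N = {#} then 1 else 0)"
  by (simp add: one_mfps_def)

lemma coeff_add [simp]: "coeff (s + t) N = coeff s N + coeff t N"
  by (simp add: plus_mfps_def)

lemma coeff_diff [simp]: "coeff (s - t) N = coeff s N - coeff t N"
  by (simp add: minus_mfps_def)

lemma coeff_uminus [simp]: "coeff (- s) N = - coeff s N"
  by (simp add: uminus_mfps_def)

lemma coeff_sum [simp]: "coeff (\<Sum>i\<in>I. f i) N = (\<Sum>i\<in>I. coeff (f i) N)"
  by (induction I rule: infinite_finite_induct) auto

lemma coeff_const: "coeff (const z) N = (if N = {#} then z else 0)"
  by (simp add: const_def)

lemma coeff_X: "coeff (X i) N = (if N = {#i#} then 1 else 0)"
  by (simp add: X_def)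

lemma coeff_d_xi: "coeff (d_xi i s) N = of_nat (Suc (count N i)) * coeff s (add_mset i N)"
  by (simp add: d_xi_def)

lemma coeff_d_x: "coeff (d_x i F y) N = wirtinger i (\<lambda>y'. coeff (F y') N) y"
  by (simp add: d_x_def)

lemma coeff_mult: "coeff (s * t) N = (\<Sum>(K, L)\<in>splits N. coeff s K * coeff t L)"
  by (simp add: times_mfps_def)

lemma coeff_const_mult [simp]: "coeff (const z * s) N = z * coeff s N"
proof -
  have "coeff (const z * s) N = (\<Sum>p\<in>splits N. if p = ({#}, N) then z * coeff s N else 0)"
    unfolding coeff_mult by (rule sum.cong) (auto simp: splits_def coeff_const split: if_splits)
  then show ?thesis
    by (simp add: sum.delta[OF finite_splits]) (simp add: splits_def)
qed

lemma coeff_X_mult: "coeff (X i * s) N = (if i \<in># N then coeff s (N - {#i#}) else 0)"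
proof -
  have "coeff (X i * s) N
      = (\<Sum>p\<in>splits N. if p = ({#i#}, N - {#i#}) then coeff s (N - {#i#}) else 0)"
    unfolding coeff_mult by (rule sum.cong) (auto simp: splits_def coeff_X split: if_splits)
  then show ?thesis
    by (simp add: sum.delta[OF finite_splits]) (auto simp: splits_def)
qed

lemma const_0 [simp]: "const 0 = 0" and const_1 [simp]: "const 1 = 1"
  by (auto intro!: mfps_eqI simp: coeff_const coeff_1)

lemma const_minus: "const (- z) = - const z"
  by (auto intro!: mfps_eqI simp: coeff_const)

lemma d_xi_0 [simp]: "d_xi i 0 = 0"
  by (rule mfps_eqI) (simp add: coeff_d_xi)

lemma d_xi_sum: "d_xi i (\<Sum>j\<in>J. f j) = (\<Sum>j\<in>J. d_xi i (f j))"
  by (rule mfps_eqI) (simp add: coeff_d_xi sum_distrib_left)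

lemma d_xi_const_mult: "d_xi i (const z * s) = const z * d_xi i s"
  by (rule mfps_eqI) (simp add: coeff_d_xi)

text \<open>The Leibniz rule for a variable as first factor. It serves to differentiate the
  condition that the Euler field annihilates \<open>U\<close>.\<close>

lemma d_xi_X_mult: "d_xi i (X j * s) = (if i = j then s else 0) + X j * d_xi i s"
proof (rule mfps_eqI)
  fix N
  show "coeff (d_xi i (X j * s)) N = coeff ((if i = j then s else 0) + X j * d_xi i s) N"
  proof (cases "j \<in># N")
    case True
    then obtain M where "N = add_mset j M"
      by (metis insert_DiffM)
    then show ?thesis
      by (auto simp: coeff_d_xi coeff_X_mult distrib_right add_mset_commute)
  qed (auto simp: coeff_d_xi coeff_X_mult simp flip: not_in_iff)
qed

text \<open>The summand for \<open>k\<close> multiplies the coefficient at \<open>N\<close> by the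
  multiplicity of \<open>k\<close> in \<open>N\<close>, and the multiplicities add up to the
  degree.\<close>

lemma coeff_euler:
  fixes s :: "'i::finite mfps"
  shows "coeff (\<Sum>k\<in>UNIV. X k * d_xi k s) N = of_nat (size N) * coeff s N"
proof -
  have "coeff (X k * d_xi k s) N = of_nat (count N k) * coeff s N" for k
  proof (cases "k \<in># N")
    case True
    then obtain M where "N = add_mset k M"
      by (metis insert_DiffM)
    then show ?thesis
      by (simp add: coeff_X_mult coeff_d_xi)
  qed (simp_all add: coeff_X_mult count_inI not_in_iff[THEN iffD1])
  moreover have "size N = (\<Sum>k\<in>UNIV. count N k)"
    unfolding size_multiset_overloaded_eq
    by (rule sum.mono_neutral_left) (auto simp: not_in_iff)
  ultimately show ?thesis
    by (simp add: sum_distrib_right)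
qed


section \<open>Series vanishing to some order on a coordinate subspace\<close>

text \<open>The series \<open>s\<close>, restricted to \<open>X i = 0\<close> for \<open>i \<notin> D\<close>, has order at least \<open>n\<close>.\<close>

definition vanishes :: "'i set \<Rightarrow> nat \<Rightarrow> 'i mfps \<Rightarrow> bool" where
  "vanishes D n s \<longleftrightarrow> (\<forall>N. set_mset N \<subseteq> D \<longrightarrow> size N < n \<longrightarrow> coeff s N = 0)"

lemma vanishes_0 [simp]: "vanishes D n 0"
  by (simp add: vanishes_def)

lemma vanishes_add: "vanishes D n s \<Longrightarrow> vanishes D n t \<Longrightarrow> vanishes D n (s + t)"
  by (simp add: vanishes_def)

lemma vanishes_diff: "vanishes D n s \<Longrightarrow> vanishes D n t \<Longrightarrow> vanishes D n (s - t)"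
  by (simp add: vanishes_def)

lemma vanishes_sum: "(\<And>i. i \<in> I \<Longrightarrow> vanishes D n (f i)) \<Longrightarrow> vanishes D n (\<Sum>i\<in>I. f i)"
  by (simp add: vanishes_def)

text \<open>If \<open>N = K + L\<close> has degree below \<open>m + n\<close>, then \<open>K\<close>
  has degree below \<open>m\<close> or \<open>L\<close> has degree below \<open>n\<close>, and both
  inherit their support in \<open>D\<close> from \<open>N\<close>.\<close>

lemma vanishes_mult:
  assumes "vanishes D m s" and "vanishes D n t"
  shows "vanishes D (m + n) (s * t)"
  unfolding vanishes_def coeff_mult
proof (intro allI impI sum.neutral ballI)
  fix N p
  assume N: "set_mset N \<subseteq> D" "size N < m + n" and p: "p \<in> splits N"
  obtain K L where p_eq: "p = (K, L)"
    by (cases p)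
  with p have KL: "N = K + L"
    by (simp add: splits_def)
  with N have "size K < m \<or> size L < n"
    by auto
  with assms N KL show "(case p of (K, L) \<Rightarrow> coeff s K * coeff t L) = 0"
    by (auto simp: p_eq vanishes_def)
qed

lemma vanishes_mult_left: "vanishes D n t \<Longrightarrow> vanishes D n (s * t)"
  using vanishes_mult[of D 0 s n t] by (simp add: vanishes_def)

lemma vanishes_mult_right: "vanishes D n s \<Longrightarrow> vanishes D n (s * t)"
  using vanishes_mult_left[of D n s t] by (simp add: mult.commute)

lemma vanishes_X: "i \<notin> D \<Longrightarrow> vanishes D n (X i)"
  by (auto simp: vanishes_def coeff_X)

lemma vanishes_X_1: "vanishes D 1 (X i)"
  by (auto simp: vanishes_def coeff_X)

text \<open>For \<open>i \<in> D\<close> the derivative is tangent to the subspace, so it passes to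
  restrictions and costs one order.\<close>

lemma vanishes_d_xi:
  assumes "i \<in> D" and "vanishes D n s"
  shows "vanishes D (n - 1) (d_xi i s)"
  using assms by (auto simp: vanishes_def coeff_d_xi)

text \<open>\<open>frechet_derivative\<close> is a choice. Both functions have the same set of
  derivatives at \<open>y\<close>, possibly empty, so the choice is the same.\<close>

lemma wirtinger_cong:
  assumes "open V" "y \<in> V" "\<And>y'. y' \<in> V \<Longrightarrow> f y' = h y'"
  shows "wirtinger i f y = wirtinger i h y"
proof -
  have "(f has_derivative E) (at y) \<longleftrightarrow> (h has_derivative E) (at y)" for E
    using has_derivative_transform_within_open[OF _ assms(1,2), of f E UNIV h]
      has_derivative_transform_within_open[OF _ assms(1,2), of h E UNIV f] assms(3) by auto
  then show ?thesis
    by (simp add: wirtinger_def frechet_derivative_def)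
qed

lemma wirtinger_const [simp]: "wirtinger i (\<lambda>_. z) y = 0"
  by (simp add: wirtinger_def Let_def split: sum.split)

lemma d_x_const [simp]: "d_x i (\<lambda>_. s) y = 0"
  by (rule mfps_eqI) (simp add: coeff_d_x)

lemma vanishes_d_x:
  assumes "open V" "y \<in> V" and "\<And>y'. y' \<in> V \<Longrightarrow> vanishes D n (F y')"
  shows "vanishes D n (d_x i F y)"
  unfolding vanishes_def coeff_d_x
proof (intro allI impI)
  fix N assume "set_mset N \<subseteq> D" "size N < n"
  with assms have "wirtinger i (\<lambda>y'. coeff (F y') N) y = wirtinger i (\<lambda>_. 0) y"
    by (intro wirtinger_cong) (auto simp: vanishes_def)
  then show "wirtinger i (\<lambda>y'. coeff (F y') N) y = 0"
    by simp
qed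


section \<open>Substitution\<close>

lemma finite_size_le: "finite {K :: 'i::finite multiset. size K \<le> n}"
proof (rule finite_subset)
  show "{K :: 'i multiset. size K \<le> n} \<subseteq> mset ` {xs. set xs \<subseteq> UNIV \<and> length xs \<le> n}"
  proof
    fix K :: "'i multiset" assume "K \<in> {K. size K \<le> n}"
    moreover obtain xs where "mset xs = K"
      using ex_mset by blast
    ultimately show "K \<in> mset ` {xs. set xs \<subseteq> UNIV \<and> length xs \<le> n}"
      by auto
  qed
  show "finite (mset ` {xs :: 'i list. set xs \<subseteq> UNIV \<and> length xs \<le> n})"
    by (intro finite_imageI finite_lists_length_le) simp
qed

lemma coeff_prod_mset_zero:
  assumes "i \<in># K" and "w i = 0"
  shows "coeff (\<Prod>i\<in>#K. w i) N = 0"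
proof -
  from \<open>i \<in># K\<close> obtain L where "K = add_mset i L"
    by (rule mset_add)
  with \<open>w i = 0\<close> show ?thesis
    by simp
qed

text \<open>A nonconstant monomial drops out through its coefficient or through a variable replaced
  by 0. This fits a series that is constant on a coordinate subspace and a \<open>w\<close> with
  values in that subspace.\<close>

lemma subst_eq_const:
  fixes s :: "'i::finite mfps" and w :: "'i \<Rightarrow> 'i mfps"
  assumes "\<And>K. K \<noteq> {#} \<Longrightarrow> coeff s K = 0 \<or> (\<exists>i\<in>#K. w i = 0)"
  shows "subst s w = const (coeff s {#})"
proof (rule mfps_eqI)
  fix N
  have summand: "coeff s K * coeff (\<Prod>i\<in>#K. w i) N
      = (if K = {#} then coeff s {#} * coeff 1 N else 0)" for K
    using assms[of K] by (cases "K = {#}") (auto dest: coeff_prod_mset_zero)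
  have "coeff (subst s w) N
      = (\<Sum>K :: 'i multiset | size K \<le> size N. if K = {#} then coeff s {#} * coeff 1 N else 0)"
    by (simp add: subst_def summand)
  also have "\<dots> = coeff (const (coeff s {#})) N"
    by (simp add: sum.delta finite_size_le coeff_1 coeff_const)
  finally show "coeff (subst s w) N = coeff (const (coeff s {#})) N" .
qed

section \<open>Substitutions that are the identity to first order\<close>

lemma coeff_prod_X: "coeff (\<Prod>i\<in>#K. X i) N = (if N = K then 1 else 0)"
proof (induction K arbitrary: N)
  case (add x K)
  then show ?case
    by (auto simp: coeff_X_mult)
qed (simp add: coeff_1)

lemma vanishes_prod_X: "vanishes D (size K) (\<Prod>i\<in>#K. X i)"
  by (auto simp: vanishes_def coeff_prod_X)

text \<open>Telescoping: one factor is exchanged at a time, and each exchange gains one order over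
  the degree of the monomial.\<close>

lemma vanishes_prod_diff:
  assumes "\<And>i. vanishes D 2 (w i - X i)"
  shows "vanishes D (Suc (size K)) ((\<Prod>i\<in>#K. w i) - (\<Prod>i\<in>#K. X i))"
proof (induction K)
  case (add x K)
  have "vanishes D 1 (w x)"
    using assms[of x] by (auto simp: vanishes_def coeff_X)
  from vanishes_mult[OF this add.IH] vanishes_mult[OF assms[of x] vanishes_prod_X[of D K]]
  have "vanishes D (Suc (Suc (size K))) (w x * ((\<Prod>i\<in>#K. w i) - (\<Prod>i\<in>#K. X i))
      + (w x - X x) * (\<Prod>i\<in>#K. X i))"
    by (intro vanishes_add) simp_all
  then show ?case
    by (simp add: algebra_simps)
qed simp

text \<open>The substitution is unitriangular with respect to the degree, hence injective.\<close>

lemma subst_eq_constD: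
  fixes s :: "'i::finite mfps" and w :: "'i \<Rightarrow> 'i mfps"
  assumes w: "\<And>i. vanishes UNIV 2 (w i - X i)" and eq: "subst s w = const z"
  shows "s = const z"
proof (rule mfps_eqI)
  have top: "coeff (\<Prod>i\<in>#K. w i) N = (if N = K then 1 else 0)" if "size N = size K" for K N
  proof -
    have "coeff ((\<Prod>i\<in>#K. w i) - (\<Prod>i\<in>#K. X i)) N = 0"
      using vanishes_prod_diff[of UNIV w K] w that unfolding vanishes_def by simp
    then show ?thesis
      by (simp add: coeff_prod_X)
  qed
  fix N
  show "coeff s N = coeff (const z) N"
  proof (induction "size N" arbitrary: N rule: less_induct)
    case less
    have "coeff (const z) N = (\<Sum>K | size K \<le> size N. coeff s K * coeff (\<Prod>i\<in>#K. w i) N)"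
      unfolding eq[symmetric] by (simp add: subst_def)
    also have "\<dots> = (\<Sum>K | size K \<le> size N. if K = N then coeff s N else 0)"
    proof (rule sum.cong)
      fix K :: "'i multiset" assume K: "K \<in> {K. size K \<le> size N}"
      show "coeff s K * coeff (\<Prod>i\<in>#K. w i) N = (if K = N then coeff s N else 0)"
      proof (cases "size K = size N")
        case True
        then show ?thesis
          using top[of N K] by simp
      next
        \<comment> \<open>By induction only the empty \<open>K\<close> can have a nonzero
          coefficient in lower degree, and its product is 1, which has no coefficient at the
          nonempty \<open>N\<close>.\<close>
        case False
        with K have lt: "size K < size N"
          by simp
        then have "coeff s K = coeff (const z) K"
          by (rule less)
        with lt show ?thesis
          by (auto simp: coeff_const coeff_1)
      qed
    qed simp
    also have "\<dots> = coeff s N"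
      by (simp add: sum.delta finite_size_le)
    finally show ?case
      by simp
  qed
qed

text \<open>Below degree 2 the outer series is \<open>- X k\<close>, so only the monomial
  \<open>{#k#}\<close> contributes. For empty \<open>N\<close> it lies outside the range of
  summation, and the missing constant term of \<open>w k\<close> makes both sides 0.\<close>

lemma coeff_subst_low:
  fixes w :: "'i::finite \<Rightarrow> 'i mfps"
  assumes u: "\<And>N. size N < 2 \<Longrightarrow> coeff s N = coeff (- X k) N" and N: "size N < 2"
    and w: "coeff (w k) {#} = 0"
  shows "coeff (subst s w) N = - coeff (w k) N"
proof -
  have "coeff (subst s w) N
      = (\<Sum>K | size K \<le> size N. if K = {#k#} then - coeff (w k) N else 0)"
    unfolding subst_def coeff_Mfps
    by (rule sum.cong) (use N in \<open>auto simp: u coeff_X\<close>)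
  also have "\<dots> = - coeff (w k) N"
    using N w by (cases N) (auto simp: sum.delta finite_size_le)
  finally show ?thesis .
qed

lemma zeta_apply_proj:
  "zeta_apply (\<lambda>i j. if i = j \<and> i \<in> D then 1 else 0) k = (if k \<in> D then X k else 0)"
proof -
  have "zeta_apply (\<lambda>i j. if i = j \<and> i \<in> D then 1 else 0) k
      = (\<Sum>j\<in>UNIV. if j = k then (if k \<in> D then X k else 0) else 0)"
    unfolding zeta_apply_def by (rule sum.cong) auto
  then show ?thesis
    by simp
qed


section \<open>Bracket of formal functions\<close>

text \<open>By antisymmetry, pairing any admissible vector field of \<open>F\<close> with the
  derivatives of \<open>G\<close> gives minus the pairing of \<open>b\<close> with the derivatives
  of \<open>F\<close>. The vector field is absent from the latter, so the arbitrary choice in the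
  definition is harmless.\<close>

lemma Omega_bracket_eq:
  fixes p :: "'i::finite \<Rightarrow> 'i \<Rightarrow> complex"
  assumes anti: "\<And>i j. p i j = - p j i"
    and F: "\<And>i. d_xi i F = (\<Sum>j\<in>UNIV. const (p i j) * a j)"
    and G: "\<And>i. d_xi i G = (\<Sum>j\<in>UNIV. const (p i j) * b j)"
  shows "Omega_bracket p F G = (\<Sum>i\<in>UNIV. a i * d_xi i G)"
proof -
  define a' where "a' = (SOME a. \<forall>i. d_xi i F = (\<Sum>j\<in>UNIV. const (p i j) * a j))"
  have a': "d_xi i F = (\<Sum>j\<in>UNIV. const (p i j) * a' j)" for i
    using someI[of "\<lambda>a. \<forall>i. d_xi i F = (\<Sum>j\<in>UNIV. const (p i j) * a j)" a] F
    unfolding a'_def by blast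
  have *: "(\<Sum>i\<in>UNIV. c i * d_xi i G) = - (\<Sum>j\<in>UNIV. b j * d_xi j F)"
    if c: "\<And>i. d_xi i F = (\<Sum>j\<in>UNIV. const (p i j) * c j)" for c
  proof -
    have "(\<Sum>i\<in>UNIV. c i * d_xi i G) = (\<Sum>i\<in>UNIV. \<Sum>j\<in>UNIV. c i * (const (p i j) * b j))"
      by (simp add: G sum_distrib_left)
    also have "\<dots> = (\<Sum>j\<in>UNIV. \<Sum>i\<in>UNIV. c i * (const (p i j) * b j))"
      by (rule sum.swap)
    also have "\<dots> = (\<Sum>j\<in>UNIV. \<Sum>i\<in>UNIV. - (b j * (const (p j i) * c i)))"
      by (intro sum.cong refl) (subst anti, simp add: const_minus algebra_simps)
    also have "\<dots> = - (\<Sum>j\<in>UNIV. b j * d_xi j F)"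
      by (simp add: c sum_distrib_left sum_negf)
    finally show ?thesis .
  qed
  show ?thesis
    unfolding Omega_bracket_def a'_def[symmetric] Let_def using *[OF a'] *[OF F] by simp
qed

text \<open>Differentiating \<open>U = \<pi> u\<close> and using the relation between
  \<open>u\<close> and \<open>v\<close> shows that \<open>v y k\<close> is a vector field for the
  value of \<open>U\<close> on the \<open>k\<close>-th coordinate 1-form, as its brackets
  require.\<close>

lemma local_dataD:
  assumes "local_data \<pi> U V u v" "y \<in> V"
  shows "d_xi i (U y k) = (\<Sum>s\<in>UNIV. const (\<pi> y i s) * v y k s)"
    and "coeff (U y k) {#} = 0"
    and "coeff (v y k s) {#} = (if k = s then 1 else 0)"
    and "size N < 2 \<Longrightarrow> coeff (u y k) N = coeff (- X k) N"
proof -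
  have U: "U y k = (\<Sum>j\<in>UNIV. const (\<pi> y k j) * u y j)"
    using assms by (auto simp: local_data_def)
  show "d_xi i (U y k) = (\<Sum>s\<in>UNIV. const (\<pi> y i s) * v y k s)"
    using assms unfolding U local_data_def by (simp add: d_xi_sum d_xi_const_mult)
  have "coeff (u y j) {#} = 0" for j
    using assms by (auto simp: local_data_def coeff_X)
  then show "coeff (U y k) {#} = 0"
    by (simp add: U)
qed (use assms in \<open>auto simp: local_data_def\<close>)

section \<open>Coordinate 1-forms\<close>

definition dx :: "'n idx \<Rightarrow> 'n covector" where
  "dx i y j = (if j = i then 1 else 0)"

lemma smooth_on_const: "smooth_on V (\<lambda>_. z)"
proof -
  have *: "\<exists>z'. fold (\<lambda>v h y'. frechet_derivative h (at y') v) vs (\<lambda>_. z) = (\<lambda>_. z')"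
    for vs :: "(complex^'n) list"
  proof (induction vs arbitrary: z)
    case (Cons v vs)
    then show ?case
      using Cons.IH[of 0] by simp
  qed auto
  show ?thesis
    unfolding smooth_on_def
  proof (intro allI ballI)
    fix vs :: "(complex^'n) list" and y
    show "fold (\<lambda>v h y'. frechet_derivative h (at y') v) vs (\<lambda>_. z) differentiable (at y)"
      using *[of vs] by auto
  qed
qed

lemma one_form_on_dx [simp]: "one_form_on V (dx i)"
  unfolding one_form_on_def dx_def by (auto simp: smooth_on_const)

lemma eval_form_dx [simp]: "eval_form U (dx i) y = U y i"
proof -
  have "eval_form U (dx i) y = (\<Sum>j\<in>UNIV. if j = i then U y i else 0)"
    unfolding eval_form_def dx_def by (rule sum.cong) auto
  then show ?thesis
    by simp
qed

lemma sharp_dx [simp]: "sharp \<pi> (dx i) y j = \<pi> y i j"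
proof -
  have "sharp \<pi> (dx i) y j = (\<Sum>s\<in>UNIV. if s = i then \<pi> y i j else 0)"
    unfolding sharp_def dx_def by (rule sum.cong) auto
  then show ?thesis
    by simp
qed

lemma biv_dx [simp]: "biv \<pi> (dx i) (dx j) y = \<pi> y i j"
proof -
  have "biv \<pi> (dx i) (dx j) y
      = (\<Sum>s\<in>UNIV. \<Sum>t\<in>UNIV. if t = j then if s = i then \<pi> y i j else 0 else 0)"
    unfolding biv_def dx_def by (intro sum.cong refl) auto
  then show ?thesis
    by simp
qed

lemma nabla_dx:
  "nabla \<pi> \<Gamma> (dx i) F y =
     (\<Sum>j\<in>UNIV. const (\<pi> y i j) * d_x j F y) +
     (\<Sum>j\<in>UNIV. \<Sum>k\<in>UNIV. const (\<Gamma> y i j k) * X j * d_xi k (F y))" (is "_ = ?r i")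
proof -
  have "nabla \<pi> \<Gamma> (dx i) F y = (\<Sum>s\<in>UNIV. if s = i then ?r i else 0)"
    unfolding nabla_def dx_def by (rule sum.cong) auto
  then show ?thesis
    by simp
qed


section \<open>Polarized Poisson structures\<close>

text \<open>The set \<open>D\<close> will be that of the holomorphic, or of the antiholomorphic, indices; the
  statements for the two cases are then instances of the same one.\<close>

definition polarized :: "'n idx set \<Rightarrow> 'n::finite tensor2 \<Rightarrow> 'n tensor3 \<Rightarrow> bool" where
  "polarized D \<pi> \<Gamma> \<longleftrightarrow>
     (\<forall>y i j. \<pi> y i j = - \<pi> y j i) \<and>
     (\<forall>y i j. (i \<in> D) = (j \<in> D) \<longrightarrow> \<pi> y i j = 0) \<and>
     (\<forall>y i j k. i \<in> D \<longrightarrow> j \<in> D \<longrightarrow> \<Gamma> y i j k = 0)"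

context
  fixes D :: "'n::finite idx set" and \<pi> :: "'n tensor2" and \<Gamma> :: "'n tensor3"
  assumes pol: "polarized D \<pi> \<Gamma>"
begin

lemma polarized_anti: "\<pi> y i j = - \<pi> y j i"
  using pol unfolding polarized_def by blast

lemma polarized_isotropic: "(i \<in> D) = (j \<in> D) \<Longrightarrow> \<pi> y i j = 0"
  using pol unfolding polarized_def by blast

lemma polarized_christoffel: "i \<in> D \<Longrightarrow> j \<in> D \<Longrightarrow> \<Gamma> y i j k = 0"
  using pol unfolding polarized_def by blast

text \<open>On the subspace only base derivatives in directions outside \<open>D\<close> survive:
  \<open>\<pi>\<close> kills the others, and each remaining Christoffel term has a factor
  \<open>X j\<close> with \<open>j \<notin> D\<close>.\<close>

lemma vanishes_nabla:
  assumes "i \<in> D" and "\<And>j. j \<notin> D \<Longrightarrow> vanishes D n (d_x j F y)"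
  shows "vanishes D n (nabla \<pi> \<Gamma> (dx i) F y)"
  unfolding nabla_dx
proof (intro vanishes_add vanishes_sum)
  fix j
  show "vanishes D n (const (\<pi> y i j) * d_x j F y)"
    using assms polarized_isotropic[of i j y] by (cases "j \<in> D") (auto intro: vanishes_mult_left)
  show "vanishes D n (const (\<Gamma> y i j k) * X j * d_xi k (F y))" for k
    using assms polarized_christoffel[of i j y k]
    by (cases "j \<in> D") (auto intro: vanishes_mult_left vanishes_mult_right vanishes_X)
qed

lemma form_bracket_dx:
  assumes "i \<in> D" "j \<in> D"
  shows "form_bracket \<pi> (dx i) (dx j) y k = 0"
proof -
  have *: "lie_form (sharp \<pi> (dx i)) (dx j) y k = 0" if "i \<in> D" "j \<in> D" for i j
    unfolding lie_form_def
  proof (intro sum.neutral ballI)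
    fix s
    show "sharp \<pi> (dx i) y s * wirtinger s (\<lambda>y'. dx j y' k) y
        + dx j y s * wirtinger k (\<lambda>y'. sharp \<pi> (dx i) y' s) y = 0"
      \<comment> \<open>The coefficients of \<open>dx j\<close> are constant. For
        \<open>s = j\<close> the component of the vector field is zero at every point, because
        \<open>D\<close> is isotropic.\<close>
      using that by (cases "s = j") (simp_all add: dx_def polarized_isotropic)
  qed
  have "biv \<pi> (dx i) (dx j) = (\<lambda>_. 0)"
    using assms by (auto simp: polarized_isotropic)
  then show ?thesis
    using assms by (simp add: form_bracket_def *)
qed

text \<open>The fibre variable \<open>X s\<close> does not depend on the base point, so its
  covariant derivatives along \<open>D\<close> restrict to 0, and so do the second ones. Hence the
  curvature factor of every summand of \<open>Omega\<close> restricts to 0.\<close>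

lemma vanishes_Qbar:
  assumes "i \<in> D" "j \<in> D"
  shows "vanishes D n (Qbar \<pi> \<Gamma> (dx i) (dx j) y)"
proof -
  have X: "vanishes D n (nabla \<pi> \<Gamma> (dx i) (\<lambda>_. X s) y)" if "i \<in> D" for i s y
    using that by (intro vanishes_nabla) auto
  have XX: "vanishes D n (nabla \<pi> \<Gamma> (dx i) (nabla \<pi> \<Gamma> (dx j) (\<lambda>_. X s)) y)"
    if "i \<in> D" "j \<in> D" for i j s
    by (rule vanishes_nabla[OF that(1)], rule vanishes_d_x[OF open_UNIV])
      (use X[OF that(2)] in auto)
  have "nabla \<pi> \<Gamma> (form_bracket \<pi> (dx i) (dx j)) F y = 0" for F
    by (simp add: nabla_def form_bracket_dx[OF assms])
  then show ?thesis
    unfolding Qbar_def Omega_def using assms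
    by (intro vanishes_mult_left vanishes_sum vanishes_diff) (auto intro!: vanishes_diff XX)
qed

text \<open>Antisymmetry turns the sum over the complement of \<open>D\<close> into derivatives of
  \<open>F\<close> along \<open>D\<close>. All derivatives are then tangent to the subspace, so
  orders of vanishing there can be tracked.\<close>

lemma bracket_split:
  assumes F: "\<And>i. d_xi i F = (\<Sum>j\<in>UNIV. const (\<pi> y i j) * a j)"
    and G: "\<And>i. d_xi i G = (\<Sum>j\<in>UNIV. const (\<pi> y i j) * b j)"
  shows "Omega_bracket (\<pi> y) F G = (\<Sum>i\<in>D. a i * d_xi i G) - (\<Sum>j\<in>D. b j * d_xi j F)"
proof -
  have restrict: "(\<Sum>j\<in>UNIV. const (\<pi> y i j) * c j)
      = (\<Sum>j\<in>(if i \<in> D then - D else D). const (\<pi> y i j) * c j)" for i c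
    by (rule sum.mono_neutral_right) (auto simp: polarized_isotropic split: if_splits)
  have "(\<Sum>i\<in>-D. a i * d_xi i G) = (\<Sum>i\<in>-D. \<Sum>j\<in>D. a i * (const (\<pi> y i j) * b j))"
    unfolding G restrict by (intro sum.cong) (auto simp: sum_distrib_left)
  also have "\<dots> = (\<Sum>j\<in>D. \<Sum>i\<in>-D. a i * (const (\<pi> y i j) * b j))"
    by (rule sum.swap)
  also have "\<dots> = (\<Sum>j\<in>D. - (b j * d_xi j F))"
  proof (rule sum.cong)
    fix j assume "j \<in> D"
    have "(\<Sum>i\<in>-D. a i * (const (\<pi> y i j) * b j)) = (\<Sum>i\<in>-D. - (b j * (const (\<pi> y j i) * a i)))"
      by (rule sum.cong) (auto simp: polarized_anti[of y _ j] const_minus algebra_simps)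
    also have "\<dots> = - (b j * d_xi j F)"
      using \<open>j \<in> D\<close> unfolding F restrict by (simp add: sum_negf sum_distrib_left)
    finally show "(\<Sum>i\<in>-D. a i * (const (\<pi> y i j) * b j)) = - (b j * d_xi j F)" .
  qed simp
  finally have "(\<Sum>i\<in>-D. a i * d_xi i G) = - (\<Sum>j\<in>D. b j * d_xi j F)"
    by (simp add: sum_negf)
  moreover have "(\<Sum>i\<in>UNIV. a i * d_xi i G) = (\<Sum>i\<in>D. a i * d_xi i G) + (\<Sum>i\<in>-D. a i * d_xi i G)"
    by (subst sum.union_disjoint[symmetric]) (auto simp: Compl_partition)
  ultimately show ?thesis
    using Omega_bracket_eq[OF polarized_anti F G] by simp
qed

text \<open>The matrix \<open>v\<close> is the identity up to order 1, and this error meets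
  derivatives of order \<open>n - 1\<close>.\<close>

lemma vanishes_leading:
  assumes "k \<in> D" "0 < n" and v: "\<And>s. coeff (v s) {#} = (if k = s then 1 else 0)"
    and G: "\<And>s. s \<in> D \<Longrightarrow> vanishes D (n - 1) (d_xi s G)"
  shows "vanishes D n ((\<Sum>s\<in>D. v s * d_xi s G) - d_xi k G)"
proof -
  have "d_xi k G = (\<Sum>s\<in>D. if s = k then d_xi k G else 0)"
    using assms by (simp add: sum.delta)
  also have "\<dots> = (\<Sum>s\<in>D. const (if k = s then 1 else 0) * d_xi s G)"
    by (rule sum.cong) auto
  finally have "(\<Sum>s\<in>D. v s * d_xi s G) - d_xi k G
      = (\<Sum>s\<in>D. (v s - const (if k = s then 1 else 0)) * d_xi s G)"
    by (simp add: sum_subtractf left_diff_distrib)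
  also have "vanishes D n \<dots>"
  proof (rule vanishes_sum)
    fix s assume "s \<in> D"
    have "vanishes D 1 (v s - const (if k = s then 1 else 0))"
      by (auto simp: vanishes_def v coeff_const)
    from vanishes_mult[OF this G[OF \<open>s \<in> D\<close>]] \<open>0 < n\<close>
    show "vanishes D n ((v s - const (if k = s then 1 else 0)) * d_xi s G)"
      by simp
  qed
  finally show ?thesis .
qed

text \<open>In the lowest degree the structure equation says that the restricted form is closed, and
  contraction of a closed form with the Euler field, which annihilates it, multiplies it by
  its degree plus one.\<close>

lemma vanishes_fedosov_form:
  assumes Y: "open Y"
    and euler: "\<And>y. y \<in> Y \<Longrightarrow> (\<Sum>i\<in>UNIV. X i * U y i) = 0"
    and data: "\<And>y. y \<in> Y \<Longrightarrow> \<exists>V u v. y \<in> V \<and> local_data \<pi> U V u v"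
    and struct: "\<And>\<alpha> \<beta> y. one_form_on Y \<alpha> \<Longrightarrow> one_form_on Y \<beta> \<Longrightarrow> y \<in> Y \<Longrightarrow>
        const (biv \<pi> \<alpha> \<beta> y) = Qbar \<pi> \<Gamma> \<alpha> \<beta> y
           - nabla \<pi> \<Gamma> \<alpha> (eval_form U \<beta>) y + nabla \<pi> \<Gamma> \<beta> (eval_form U \<alpha>) y
           + eval_form U (form_bracket \<pi> \<alpha> \<beta>) y
           + Omega_bracket (\<pi> y) (eval_form U \<alpha> y) (eval_form U \<beta> y)"
    and "k \<in> D" "y \<in> Y"
  shows "vanishes D n (U y k)"
  using \<open>k \<in> D\<close> \<open>y \<in> Y\<close>
proof (induction n arbitrary: k y)
  case 0
  then show ?case by (simp add: vanishes_def)
next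
  case (Suc n m y)
  obtain V u v where V: "y \<in> V" "local_data \<pi> U V u v"
    using data[OF Suc.prems(2)] by blast
  note d = local_dataD[OF V(2,1)]
  show ?case
  proof (cases "n = 0")
    case True
    then show ?thesis by (auto simp: vanishes_def d(2))
  next
    case False
    have closed: "vanishes D n (d_xi k (U y m) - d_xi m (U y k))" if k: "k \<in> D" for k
    proof -
      \<comment> \<open>The induction hypothesis holds on all of the open set \<open>Y\<close>, so
        it survives differentiation along the base without loss of order.\<close>
      have nabla: "vanishes D n (nabla \<pi> \<Gamma> (dx i) (eval_form U (dx j)) y)"
        if "i \<in> D" "j \<in> D" for i j
        using that Y Suc by (intro vanishes_nabla vanishes_d_x[of Y]) auto
      have bracket: "Omega_bracket (\<pi> y) (U y k) (U y m)
          = nabla \<pi> \<Gamma> (dx k) (eval_form U (dx m)) y - nabla \<pi> \<Gamma> (dx m) (eval_form U (dx k)) y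
            - Qbar \<pi> \<Gamma> (dx k) (dx m) y"
        using struct[of "dx k" "dx m" y] Suc.prems k
        by (simp add: polarized_isotropic eval_form_def[of U "form_bracket _ _ _"] form_bracket_dx
            algebra_simps)
      have "vanishes D n (Omega_bracket (\<pi> y) (U y k) (U y m))"
        unfolding bracket using k Suc.prems by (intro vanishes_diff nabla vanishes_Qbar)
      moreover have lead: "vanishes D n ((\<Sum>s\<in>D. v y i s * d_xi s (U y j)) - d_xi i (U y j))"
        if "i \<in> D" "j \<in> D" for i j
        using that False by (intro vanishes_leading vanishes_d_xi Suc) (auto simp: d(3) Suc)
      ultimately show ?thesis
        using lead[OF k Suc.prems(1)] lead[OF Suc.prems(1) k]
          bracket_split[of "U y k" y "v y k" "U y m" "v y m", OF d(1) d(1)]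
        by (simp add: vanishes_def)
    qed
    \<comment> \<open>Differentiating the Euler condition trades \<open>d_xi m (U y i)\<close> for
      \<open>U y m\<close>, so the Euler operator plus 1 applied to \<open>U y m\<close> is a
      contraction of the nearly closed form.\<close>
    have "0 = d_xi m (\<Sum>i\<in>UNIV. X i * U y i)"
      by (simp add: euler Suc.prems)
    also have "\<dots> = (\<Sum>i\<in>UNIV. if i = m then U y m else 0) + (\<Sum>i\<in>UNIV. X i * d_xi m (U y i))"
      by (simp add: d_xi_sum d_xi_X_mult sum.distrib eq_commute[of m])
    finally have contract: "(\<Sum>i\<in>UNIV. X i * d_xi i (U y m)) + U y m
        = (\<Sum>i\<in>UNIV. X i * (d_xi i (U y m) - d_xi m (U y i)))"
      by (simp add: right_diff_distrib sum_subtractf eq_neg_iff_add_eq_0)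
    have "vanishes D (Suc n) ((\<Sum>i\<in>UNIV. X i * d_xi i (U y m)) + U y m)"
      unfolding contract
    proof (rule vanishes_sum)
      fix i
      show "vanishes D (Suc n) (X i * (d_xi i (U y m) - d_xi m (U y i)))"
        using vanishes_mult[OF vanishes_X_1 closed] vanishes_mult_right[OF vanishes_X]
        by (cases "i \<in> D") auto
    qed
    moreover have "coeff ((\<Sum>i\<in>UNIV. X i * d_xi i (U y m)) + U y m) N
        = of_nat (Suc (size N)) * coeff (U y m) N" for N
      unfolding coeff_add coeff_euler by (simp add: algebra_simps)
    ultimately show ?thesis
      by (simp add: vanishes_def del: of_nat_Suc coeff_add)
  qed
qed

text \<open>Along \<open>D\<close> the left side of \<open>flat\<close> involves only base
  derivatives that kill \<open>f\<close>, hence vanishes to order \<open>n\<close> by induction. On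
  the right the derivatives of \<open>U\<close> vanish on the subspace, and the rest is the fibre
  derivative of \<open>F\<close> up to order \<open>n\<close>. So \<open>F\<close> gains one
  degree.\<close>

lemma vanishes_theta:
  assumes Y: "open Y"
    and U: "\<And>k y n. k \<in> D \<Longrightarrow> y \<in> Y \<Longrightarrow> vanishes D n (U y k)"
    and data: "\<And>y. y \<in> Y \<Longrightarrow> \<exists>V u v. y \<in> V \<and> local_data \<pi> U V u v"
    and H: "\<And>y i. y \<in> Y \<Longrightarrow> d_xi i (F y) = (\<Sum>j\<in>UNIV. const (\<pi> y i j) * a y j)"
    and flat: "\<And>\<alpha> y. one_form_on Y \<alpha> \<Longrightarrow> y \<in> Y \<Longrightarrow>
        nabla \<pi> \<Gamma> \<alpha> F y = Omega_bracket (\<pi> y) (eval_form U \<alpha> y) (F y)"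
    and init: "\<And>y. y \<in> Y \<Longrightarrow> coeff (F y) {#} = f y"
    and f: "\<And>j y. j \<notin> D \<Longrightarrow> y \<in> Y \<Longrightarrow> wirtinger j f y = 0"
    and "y \<in> Y"
  shows "vanishes D n (F y - const (f y))"
  using \<open>y \<in> Y\<close>
proof (induction n arbitrary: y)
  case 0
  then show ?case by (simp add: vanishes_def)
next
  case (Suc n y)
  obtain V u v where V: "y \<in> V" "local_data \<pi> U V u v"
    using data[OF Suc.prems] by blast
  note d = local_dataD[OF V(2,1)]
  show ?case
  proof (cases "n = 0")
    case True
    with Suc.prems show ?thesis by (auto simp: vanishes_def init coeff_const)
  next
    case False
    have dF: "vanishes D (n - 1) (d_xi s (F y))" if "s \<in> D" for s
      using that Suc.IH[OF Suc.prems] by (auto simp: vanishes_def coeff_d_xi coeff_const)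
    have d_x: "vanishes D n (d_x j F y)" if "j \<notin> D" for j
      unfolding vanishes_def coeff_d_x
    proof (intro allI impI)
      fix N assume N: "set_mset N \<subseteq> D" "size N < n"
      \<comment> \<open>Near \<open>y\<close> the constant term is \<open>f\<close>, and the other
        coefficients in question vanish by induction.\<close>
      have "wirtinger j (\<lambda>y'. coeff (F y') N) y
          = wirtinger j (if N = {#} then f else (\<lambda>_. 0)) y"
        using Suc.IH N Suc.prems
        by (intro wirtinger_cong[OF Y]) (auto simp: vanishes_def init coeff_const)
      then show "wirtinger j (\<lambda>y'. coeff (F y') N) y = 0"
        using that Suc.prems by (simp add: f)
    qed
    have "vanishes D n (d_xi k (F y))" if k: "k \<in> D" for k
    proof -
      have "vanishes D n (Omega_bracket (\<pi> y) (U y k) (F y))"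
        using flat[of "dx k" y] Suc.prems vanishes_nabla[of k n F y, OF k d_x] by simp
      moreover have "vanishes D n ((\<Sum>s\<in>D. v y k s * d_xi s (F y)) - d_xi k (F y))"
        using k False dF by (intro vanishes_leading) (auto simp: d(3))
      moreover have "vanishes D n (\<Sum>s\<in>D. a y s * d_xi s (U y k))"
        using vanishes_d_xi[OF _ U[OF k Suc.prems, of "Suc n"]]
        by (intro vanishes_sum vanishes_mult_left) simp
      ultimately show ?thesis
        using bracket_split[of "U y k" y "v y k" "F y" "a y", OF d(1) H[OF Suc.prems]]
        by (simp add: vanishes_def)
    qed
    then have step: "coeff (F y) (add_mset k N) = 0"
      if "k \<in> D" "set_mset N \<subseteq> D" "size N < n" for k N
      using that by (auto simp: vanishes_def coeff_d_xi simp del: of_nat_Suc)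
    show ?thesis
      unfolding vanishes_def
    proof (intro allI impI)
      fix N assume "set_mset N \<subseteq> D" "size N < Suc n"
      then show "coeff (F y - const (f y)) N = 0"
        using step Suc.prems by (cases N) (auto simp: coeff_const init)
    qed
  qed
qed

end


section \<open>Holomorphic and antiholomorphic functions\<close>

text \<open>Conjugation is real linear, so it commutes with the derivative, but it changes the sign
  of \<open>\<i>\<close> and thereby swaps the two kinds of Wirtinger derivative.\<close>

lemma wirtinger_cnj:
  assumes "f differentiable (at y)"
  shows "wirtinger (Inl k) (\<lambda>y. cnj (f y)) y = cnj (wirtinger (Inr k) f y)"
proof -
  have "frechet_derivative (\<lambda>y. cnj (f y)) (at y) = (\<lambda>x. cnj (frechet_derivative f (at y) x))"
    using has_derivative_cnj[OF assms[unfolded frechet_derivative_works]]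
    by (rule frechet_derivative_at[symmetric])
  then show ?thesis
    by (simp add: wirtinger_def Let_def)
qed

lemma smooth_on_cnj:
  fixes f :: "complex^'n \<Rightarrow> complex"
  assumes V: "open V" and f: "smooth_on V f"
  shows "smooth_on V (\<lambda>y. cnj (f y))"
proof -
  define ds :: "(complex^'n) list \<Rightarrow> (complex^'n \<Rightarrow> complex) \<Rightarrow> complex^'n \<Rightarrow> complex"
    where "ds vs = fold (\<lambda>v h y'. frechet_derivative h (at y') v) vs" for vs
  have diff: "ds vs f differentiable (at y)" if "y \<in> V" for vs y
    using f that by (auto simp: smooth_on_def ds_def)
  have *: "ds vs (\<lambda>y. cnj (f y)) y = cnj (ds vs f y)" if "y \<in> V" for vs y
    using that
  \<comment> \<open>\<open>fold\<close> applies the last direction outermost, so induction from the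
    right peels off the last derivative taken.\<close>
  proof (induction vs arbitrary: y rule: rev_induct)
    case (snoc v vs)
    have "(ds vs (\<lambda>y. cnj (f y)) has_derivative
        (\<lambda>x. cnj (frechet_derivative (ds vs f) (at y) x))) (at y)"
      using has_derivative_cnj[OF diff[OF snoc.prems, of vs, unfolded frechet_derivative_works]]
      by (rule has_derivative_transform_within_open[OF _ V snoc.prems]) (simp add: snoc.IH)
    from frechet_derivative_at[OF this, symmetric] show ?case
      by (simp add: ds_def)
  qed (simp add: ds_def)
  have "ds vs (\<lambda>y. cnj (f y)) differentiable (at y)" if "y \<in> V" for vs y
  proof -
    have "((\<lambda>y. cnj (ds vs f y)) has_derivative
        (\<lambda>x. cnj (frechet_derivative (ds vs f) (at y) x))) (at y)"
      using has_derivative_cnj[OF diff[OF that, unfolded frechet_derivative_works]] .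
    then have "(ds vs (\<lambda>y. cnj (f y)) has_derivative
        (\<lambda>x. cnj (frechet_derivative (ds vs f) (at y) x))) (at y)"
      by (rule has_derivative_transform_within_open[OF _ V that]) (simp add: *)
    then show ?thesis
      by (auto simp: differentiable_def)
  qed
  then show ?thesis
    by (simp add: smooth_on_def ds_def)
qed

lemma open_img:
  assumes A: "complex_atlas A" "c \<in> A" and W: "open W"
  shows "open (img c W)"
proof -
  have op: "open (img c UNIV)" and hom: "homeomorphism (fst c) (img c UNIV) (snd c) (pt c)"
    using A by (auto simp: complex_atlas_def)
  have "openin (top_of_set (img c UNIV)) (img c W)"
    unfolding img_def[of c W] using W
    by (intro homeomorphism_imp_open_map[OF hom] openin_open_Int)
  with op show ?thesis
    by (metis openin_open_eq)
qed

lemma antiholo_fun_smooth: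
  assumes A: "complex_atlas A" and W: "open W" and b: "antiholo_fun A W b"
  shows "smooth_fun A W b"
  unfolding smooth_fun_def
proof
  fix c assume c: "c \<in> A"
  have "smooth_on (img c W) ((\<lambda>p. cnj (b p)) \<circ> pt c)"
    using b c by (simp add: antiholo_fun_def holo_fun_def holo_on_def)
  from smooth_on_cnj[OF open_img[OF A c W] this] show "smooth_on (img c W) (b \<circ> pt c)"
    by (simp add: comp_def)
qed

lemma antiholo_fun_wirtinger:
  assumes b: "antiholo_fun A W b" and "c \<in> A" "y \<in> img c W"
  shows "wirtinger (Inl k) (b \<circ> pt c) y = 0"
proof -
  let ?b = "\<lambda>y. cnj (b (pt c y))"
  have h: "holo_on (img c W) ?b"
    using assms by (simp add: antiholo_fun_def holo_fun_def comp_def)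
  then have "\<forall>vs. fold (\<lambda>v h y'. frechet_derivative h (at y') v) vs ?b differentiable (at y)"
    using assms by (simp add: holo_on_def smooth_on_def)
  from spec[OF this, of "[]"] have "?b differentiable (at y)"
    by simp
  from wirtinger_cnj[OF this, of k] h assms show ?thesis
    by (simp add: holo_on_def comp_def)
qed


section \<open>Separation of variables\<close>

lemma polarized_kp:
  fixes g :: "complex^'n \<Rightarrow> 'n::finite \<Rightarrow> 'n \<Rightarrow> complex"
  assumes "D = Collect isl \<or> D = - Collect isl"
  shows "polarized D (kp_tensor g) (kp_connection g)"
  unfolding polarized_def
proof (intro conjI allI impI)
  fix i j k :: "'n idx" and y
  show "kp_tensor g y i j = - kp_tensor g y j i"
    by (simp add: kp_tensor_def split: sum.split)
  show "kp_tensor g y i j = 0" if "(i \<in> D) = (j \<in> D)"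
    using assms that by (auto simp: kp_tensor_def split: sum.split)
  show "kp_connection g y i j k = 0" if "i \<in> D" "j \<in> D"
    using assms that by (auto simp: kp_connection_def split: sum.split)
qed

text \<open>\<open>F\<close> restricts to \<open>f\<close> to every order, and \<open>w\<close>
  takes values in the subspace, so the substitution sees only this restriction.\<close>

lemma subst_theta:
  assumes pol: "polarized D (\<pi> c) (\<Gamma> c)" and U: "fedosov_form A \<pi> \<Gamma> U" and c: "c \<in> A"
    and F: "is_theta A \<pi> \<Gamma> U W f F" and op: "open (img c W)" and y: "y \<in> img c W"
    and f: "\<And>j y. j \<notin> D \<Longrightarrow> y \<in> img c W \<Longrightarrow> wirtinger j (f \<circ> pt c) y = 0"
    and w: "\<And>k. k \<notin> D \<Longrightarrow> w k = 0"
  shows "subst (F c y) w = const (f (pt c y))"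
proof -
  have sub: "img c W \<subseteq> img c UNIV"
    by (auto simp: img_def)
  have data: "\<exists>V u v. y \<in> V \<and> local_data (\<pi> c) (U c) V u v" if "y \<in> img c W" for y
  proof -
    have "y \<in> img c UNIV"
      using sub that by blast
    with U c have "\<exists>V. open V \<and> y \<in> V \<and> V \<subseteq> img c UNIV \<and> (\<exists>u v. local_data (\<pi> c) (U c) V u v)"
      by (simp add: fedosov_form_def)
    then show ?thesis
      by blast
  qed
  have U0: "vanishes D n (U c y k)" if k: "k \<in> D" and y: "y \<in> img c W" for k y n
  proof (rule vanishes_fedosov_form[OF pol op _ _ _ k y])
    show "(\<Sum>i\<in>UNIV. X i * U c y i) = 0" if "y \<in> img c W" for y
      using U c subsetD[OF sub that] by (simp add: fedosov_form_def)
  next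
    show "\<exists>V u v. y \<in> V \<and> local_data (\<pi> c) (U c) V u v" if "y \<in> img c W" for y
      by (rule data[OF that])
  next
    fix \<alpha> \<beta> y
    assume "one_form_on (img c W) \<alpha>" "one_form_on (img c W) \<beta>" "y \<in> img c W"
    with U c sub op
    show "const (biv (\<pi> c) \<alpha> \<beta> y) = Qbar (\<pi> c) (\<Gamma> c) \<alpha> \<beta> y
           - nabla (\<pi> c) (\<Gamma> c) \<alpha> (eval_form (U c) \<beta>) y
           + nabla (\<pi> c) (\<Gamma> c) \<beta> (eval_form (U c) \<alpha>) y
           + eval_form (U c) (form_bracket (\<pi> c) \<alpha> \<beta>) y
           + Omega_bracket (\<pi> c y) (eval_form (U c) \<alpha> y) (eval_form (U c) \<beta> y)"
      by (simp add: fedosov_form_def)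
  qed
  from F have "H_Omega A \<pi> W F"
    by (simp add: is_theta_def)
  then obtain a where "\<forall>c\<in>A. \<forall>y\<in>img c W. \<forall>i.
      d_xi i (F c y) = (\<Sum>j\<in>UNIV. const (\<pi> c y i j) * a c y j)"
    unfolding H_Omega_def by (elim conjE exE)
  with c have a: "d_xi i (F c y) = (\<Sum>j\<in>UNIV. const (\<pi> c y i j) * a c y j)"
    if "y \<in> img c W" for y i
    using that by simp
  have init: "coeff (F c y) {#} = (f \<circ> pt c) y" if "y \<in> img c W" for y
    using F c that by (simp add: is_theta_def)
  have order: "vanishes D (Suc n) (F c y - const ((f \<circ> pt c) y))" for n
  proof (rule vanishes_theta[OF pol op U0 data a _ init f y])
    fix \<alpha> y
    assume "one_form_on (img c W) \<alpha>" "y \<in> img c W"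
    moreover have "\<forall>V \<alpha>. open V \<and> V \<subseteq> img c W \<and> one_form_on V \<alpha> \<longrightarrow>
        (\<forall>y\<in>V. nabla (\<pi> c) (\<Gamma> c) \<alpha> (F c) y
          = Omega_bracket (\<pi> c y) (eval_form (U c) \<alpha> y) (F c y))"
      using F c by (simp add: is_theta_def)
    note this[rule_format, of "img c W" \<alpha>]
    ultimately show "nabla (\<pi> c) (\<Gamma> c) \<alpha> (F c) y
        = Omega_bracket (\<pi> c y) (eval_form (U c) \<alpha> y) (F c y)"
      using op by simp
  qed
  \<comment> \<open>Order \<open>Suc (size K)\<close> is the first that reaches the coefficient at
    \<open>K\<close>.\<close>
  have F0: "coeff (F c y) K = 0" if "set_mset K \<subseteq> D" "K \<noteq> {#}" for K
    using that order[of "size K"] by (simp add: vanishes_def coeff_const)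
  have "subst (F c y) w = const (coeff (F c y) {#})"
    by (rule subst_eq_const) (use F0 w in blast)
  then show ?thesis
    by (simp add: init[OF y])
qed

lemma zeta_apply_holo_proj: "zeta_apply (holo_proj y) k = (if isl k then X k else 0)"
  using zeta_apply_proj[of "Collect isl" k] by (simp add: holo_proj_def[abs_def])

lemma zeta_apply_antiholo_proj: "zeta_apply (antiholo_proj y) k = (if isl k then 0 else X k)"
  using zeta_apply_proj[of "- Collect isl" k]
  by (simp add: antiholo_proj_def[abs_def] if_distrib cong: if_cong)

text \<open>To first order \<open>u p\<close> is \<open>- X p\<close>, so the two substitutions
  contribute the \<open>P\<close> and the \<open>Q\<close> component of \<open>\<zeta>\<close> with
  positive sign, and the two projections add up to the identity.\<close>

lemma xi_of_zeta_leading: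
  fixes u :: "complex^'n \<Rightarrow> 'n::finite idx \<Rightarrow> 'n idx mfps"
  assumes "local_data \<pi> U V u v" "y \<in> V"
  shows "vanishes UNIV 2 (xi_of_zeta (holo_proj y) (antiholo_proj y) (u y) p - X p)"
  unfolding vanishes_def
proof (intro allI impI)
  fix N :: "'n idx multiset" assume N: "size N < 2"
  have "coeff (subst (u y p) w) N = - coeff (w p) N" if "coeff (w p) {#} = 0" for w
    using coeff_subst_low[of "u y p" p N w] local_dataD(4)[OF assms] N that by blast
  then show "coeff (xi_of_zeta (holo_proj y) (antiholo_proj y) (u y) p - X p) N = 0"
    by (simp add: xi_of_zeta_def zeta_apply_holo_proj zeta_apply_antiholo_proj coeff_X)
qed

theorem proposition5:
  fixes A :: "('m::{t2_space,second_countable_topology}, 'n::finite) chart set"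
    and g :: "('m, 'n) chart \<Rightarrow> complex^'n \<Rightarrow> 'n \<Rightarrow> 'n \<Rightarrow> complex"
    and S T :: "'m set \<Rightarrow> ('m \<Rightarrow> complex) \<Rightarrow> ('m, 'n) chart \<Rightarrow> 'n formal"
  assumes "complex_atlas A"
    and "kaehler_poisson A g"
    and "fedosov_groupoid_maps A (\<lambda>c. kp_tensor (g c)) (\<lambda>c. kp_connection (g c))
           (\<lambda>_. holo_proj) (\<lambda>_. antiholo_proj) S T"
  shows "separation_of_variables A S T"
proof -
  let ?\<pi> = "\<lambda>c. kp_tensor (g c)" and ?\<Gamma> = "\<lambda>c. kp_connection (g c)"
  obtain U where U: "fedosov_form A ?\<pi> ?\<Gamma> U"
    and maps: "\<And>W f. open W \<Longrightarrow> smooth_fun A W f \<Longrightarrow>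
      \<exists>F. is_theta A ?\<pi> ?\<Gamma> U W f F \<and>
        (\<forall>c\<in>A. \<forall>y0\<in>img c W. \<exists>V u v. y0 \<in> V \<and> local_data (?\<pi> c) (U c) V u v \<and>
          (\<forall>y\<in>V.
             subst (S W f c y) (xi_of_zeta (holo_proj y) (antiholo_proj y) (u y))
               = subst (F c y) (\<lambda>k. - zeta_apply (holo_proj y) k) \<and>
             subst (T W f c y) (xi_of_zeta (holo_proj y) (antiholo_proj y) (u y))
               = subst (F c y) (zeta_apply (antiholo_proj y))))"
    using assms(3) unfolding fedosov_groupoid_maps_def by metis
  have "S W a c y = pullback a c y"
    if W: "open W" and a: "holo_fun A W a" and c: "c \<in> A" and y: "y \<in> img c W" for W a c y
  proof -
    have "smooth_fun A W a"
      using a by (simp add: holo_fun_def holo_on_def smooth_fun_def)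
    from maps[OF W this] c y obtain F V u v where F: "is_theta A ?\<pi> ?\<Gamma> U W a F"
      and V: "local_data (?\<pi> c) (U c) V u v" "y \<in> V"
      and S: "subst (S W a c y) (xi_of_zeta (holo_proj y) (antiholo_proj y) (u y))
               = subst (F c y) (\<lambda>k. - zeta_apply (holo_proj y) k)"
      by blast
    have wirtinger: "wirtinger j (a \<circ> pt c) y = 0" if "j \<notin> Collect isl" "y \<in> img c W" for j y
      using that a c by (cases j) (auto simp: holo_fun_def holo_on_def)
    have "subst (F c y) (\<lambda>k. - zeta_apply (holo_proj y) k) = const (a (pt c y))"
    proof (rule subst_theta[OF _ U c F open_img[OF assms(1) c W] y wirtinger])
      show "polarized (Collect isl) (?\<pi> c) (?\<Gamma> c)"
        by (simp add: polarized_kp)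
    qed (auto simp: zeta_apply_holo_proj)
    \<comment> \<open>In the variables \<open>\<zeta>\<close> the source map gives a constant
      series; injectivity of the change of variables carries this back to
      \<open>\<xi>\<close>.\<close>
    then show ?thesis
      unfolding pullback_def using S subst_eq_constD[OF xi_of_zeta_leading[OF V]] by simp
  qed
  moreover have "T W b c y = pullback b c y"
    if W: "open W" and b: "antiholo_fun A W b" and c: "c \<in> A" and y: "y \<in> img c W" for W b c y
  proof -
    from maps[OF W antiholo_fun_smooth[OF assms(1) W b]] c y obtain F V u v
      where F: "is_theta A ?\<pi> ?\<Gamma> U W b F"
      and V: "local_data (?\<pi> c) (U c) V u v" "y \<in> V"
      and T: "subst (T W b c y) (xi_of_zeta (holo_proj y) (antiholo_proj y) (u y))
               = subst (F c y) (zeta_apply (antiholo_proj y))"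
      by blast
    have wirtinger: "wirtinger j (b \<circ> pt c) y = 0" if "j \<notin> - Collect isl" "y \<in> img c W" for j y
      using that antiholo_fun_wirtinger[OF b c] by (cases j) auto
    have "subst (F c y) (zeta_apply (antiholo_proj y)) = const (b (pt c y))"
    proof (rule subst_theta[OF _ U c F open_img[OF assms(1) c W] y wirtinger])
      show "polarized (- Collect isl) (?\<pi> c) (?\<Gamma> c)"
        by (simp add: polarized_kp)
    qed (auto simp: zeta_apply_antiholo_proj)
    then show ?thesis
      unfolding pullback_def using T subst_eq_constD[OF xi_of_zeta_leading[OF V]] by simp
  qed
  ultimately show ?thesis
    by (simp add: separation_of_variables_def)
qed

end
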